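(* Let $\bar{x}$ be a feasible point of (NSOCP). If $\bar{x}$ satisfies seq-CPLD (respectively, seq-CRCQ), then: 1. there is a neighborhood $\mathcal{V}$ of $\bar{x}$ such that every feasible point $x\in\mathcal{V}$ also satisfies seq-CPLD (respectively, seq-CRCQ); 2. MSCQ holds at $\bar{x}$.
   Context: Norms are Euclidean. For $m\ge 2$ write $y=(y_0,\widehat{y})\in\mathbb{R}\times\mathbb{R}^{m-1}$, and let $\mathbb{L}_m=\{y\in\mathbb{R}^m: y_0\ge\|\widehat{y}\|\}$ be the second-order cone. Let $\mathrm{bd}_+\mathbb{L}_m$ be its boundary minus the origin. Problem (NSOCP): minimize $f(x)$ over $x\in\mathbb{R}^n$ subject to $g_j(x)\in\mathbb{L}_{m_j}$, $j=1,\dots,q$, where $f:\mathbb{R}^n\to\mathbb{R}$ and $g_j=(g_{j,0},\widehat{g}_j):\mathbb{R}^n\to\mathbb{R}^{m_j}$ are continuously differentiable and $m_j\ge 2$ for all $j$. $\mathcal{F}$ is the feasible set and $D$ denotes the Jacobian matrix. For feasible $x$: $I_0(x)=\{j: g_j(x)=0\}$, $I_B(x)=\{j: g_j(x)\in\mathrm{bd}_+\mathbb{L}_{m_j}\}$. Eigenvectors: for $y\in\mathbb{R}^m$, $u_1(y)=\frac12(1,-w)$ and $u_2(y)=\frac12(1,w)$, where $w=\widehat{y}/\|\widehat{y}\|$ if $\widehat{y}\ne0$, and $w\in\mathbb{R}^{m-1}$ is any unit vector (free choice, the same $w$ for $u_1$ and $u_2$) if $\widehat{y}=0$. For index sets $J_B,J_-,J_+\subseteq\{1,\dots,q\}$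 with $\widehat{g}_j(x)\neq0$ for $j\in J_B$, and $w=[w_j]_{j\in J_-\cup J_+}$, let $\mathcal{D}_{J_B,J_-,J_+}(x,w)$ be the (indexed) family of vectors $$\left\{Dg_{j}(x)^\top u_1(g_j(x))\right\}_{j\in J_B}\cup\left\{Dg_{j}(x)^\top (1,-w_j)\right\}_{j\in J_-}\cup\left\{Dg_{j}(x)^\top (1,w_j)\right\}_{j\in J_{+}}.$$ A finite (indexed) family of vectors is positively linearly dependent if some linear combination of it with nonnegative coefficients, not all zero, vanishes. Seq-CRCQ (respectively, seq-CPLD) holds at a feasible $\bar{x}$ if: for all sequences $x^k\to\bar{x}$ in $\mathbb{R}^n$ and $\Delta_j^k\to0$ in $\mathbb{R}^{m_j}$, $j\in I_0(\bar{x})\cup I_B(\bar{x})$, there exist an infinite set $I\subseteq\mathbb{N}$ and (a choice of) eigenvectors $u_1(g_j(x^k)+\Delta_j^k)=\frac12(1,-w_j^k)$, $u_2(g_j(x^k)+\Delta_j^k)=\frac12(1,w_j^k)$, $k\in I$, $j\in I_0(\bar{x})$, converging along $k\in I$ to $\frac12(1,-\bar{w}_j)$ and $\frac12(1,\bar{w}_j)$, respectively, with $\|\bar{w}_j\|=1$, such that for all subsets $J_B\subseteq I_B(\bar{x})$ and $J_-,J_+\subseteq I_0(\bar{x})$: if $\mathcal{D}_{J_B,J_-,J_+}(\bar{x},\bar{w})$ is linearly dependent (respectively, positively linearly dependent), then $\mathcal{D}_{J_B,J_-,J_+}(x^k,w^k)$ is linearly dependent for all sufficiently large $k\in I$, where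 $\bar{w}=[\bar{w}_j]_{j\in J_-\cup J_+}$ and $w^k=[w_j^k]_{j\in J_-\cup J_+}$. MSCQ (metric subregularity CQ) holds at a feasible $\bar{x}$ if there exist $\gamma>0$ and a neighborhood $\mathcal{V}$ of $\bar{x}$ such that $\mathrm{dist}(x,\mathcal{F})\le\gamma\,\mathrm{dist}\left(g(x),\prod_{j=1}^q\mathbb{L}_{m_j}\right)$ for every $x\in\mathcal{V}$, where $g(x)=(g_1(x),\dots,g_q(x))$. *)

theory Defs
  imports "HOL-Analysis.Analysis"
begin

text \<open>
  The dimensions \<open>m j\<close> depend on the constraint index, so \<open>\<real>\<^sup>m\<close> is the library space
  \<^term>\<open>Euclidean_space m\<close>, whose points are the \<open>y :: nat \<Rightarrow> real\<close> with \<open>y i = 0\<close> for all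
  \<open>i \<ge> m\<close>. A point \<open>y = (y\<^sub>0, y')\<close> of \<open>\<real>\<^sup>m\<close> has \<open>y\<^sub>0 = y 0\<close> and \<open>y' = hat y\<close>, a point of
  \<^term>\<open>Euclidean_space (m - 1)\<close>; conversely \<open>(a, v)\<close> is \<^term>\<open>case_nat a v\<close>.
\<close>

definition enorm :: "nat \<Rightarrow> (nat \<Rightarrow> real) \<Rightarrow> real"
  where "enorm m y = L2_set y {..<m}"

definition hat :: "(nat \<Rightarrow> real) \<Rightarrow> nat \<Rightarrow> real"
  where "hat y = (\<lambda>i. y (Suc i))"

definition soc :: "nat \<Rightarrow> (nat \<Rightarrow> real) set"
  where "soc m = {y \<in> topspace (Euclidean_space m). enorm (m - 1) (hat y) \<le> y 0}"

definition bd_plus :: "nat \<Rightarrow> (nat \<Rightarrow> real) set"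
  where "bd_plus m = (Euclidean_space m frontier_of soc m) - {\<lambda>_. 0}"

definition unit_vec :: "nat \<Rightarrow> (nat \<Rightarrow> real) \<Rightarrow> bool"
  where "unit_vec d w \<longleftrightarrow> w \<in> topspace (Euclidean_space d) \<and> enorm d w = 1"

definition normalize_hat :: "nat \<Rightarrow> (nat \<Rightarrow> real) \<Rightarrow> nat \<Rightarrow> real"
  where "normalize_hat m y = (\<lambda>i. hat y i / enorm (m - 1) (hat y))"

text \<open>\<open>eig_dir m y w\<close>: the vectors \<open>(1, -w) / 2\<close> and \<open>(1, w) / 2\<close> are an admissible choice of
  eigenvectors \<open>u\<^sub>1(y)\<close>, \<open>u\<^sub>2(y)\<close> of \<open>y \<in> \<real>\<^sup>m\<close>.\<close>

definition eig_dir :: "nat \<Rightarrow> (nat \<Rightarrow> real) \<Rightarrow> (nat \<Rightarrow> real) \<Rightarrow> bool"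
  where "eig_dir m y w \<longleftrightarrow>
    (if hat y \<noteq> (\<lambda>_. 0) then w = normalize_hat m y else unit_vec (m - 1) w)"

definition eigvec1 :: "(nat \<Rightarrow> real) \<Rightarrow> nat \<Rightarrow> real"
  where "eigvec1 w = (\<lambda>i. 1/2 * case_nat 1 (\<lambda>l. - w l) i)"

definition eigvec2 :: "(nat \<Rightarrow> real) \<Rightarrow> nat \<Rightarrow> real"
  where "eigvec2 w = (\<lambda>i. 1/2 * case_nat 1 w i)"

definition C1 :: "('a::real_normed_vector \<Rightarrow> 'b::real_normed_vector) \<Rightarrow> bool"
  where "C1 h \<longleftrightarrow> (\<exists>h' :: 'a \<Rightarrow> 'a \<Rightarrow>\<^sub>L 'b.
    (\<forall>x. (h has_derivative blinfun_apply (h' x)) (at x)) \<and> continuous_on UNIV h')"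

text \<open>Entry \<open>(i, l)\<close> of the Jacobian matrix \<open>Dh(x)\<close>, and the product \<open>Dh(x)\<^sup>T v\<close>,
  for \<open>h : \<real>\<^sup>n \<rightarrow> \<real>\<^sup>m\<close>.\<close>

definition jac :: "(real ^ 'n \<Rightarrow> nat \<Rightarrow> real) \<Rightarrow> real ^ 'n \<Rightarrow> nat \<Rightarrow> 'n \<Rightarrow> real"
  where "jac h x i l = frechet_derivative (\<lambda>z. h z i) (at x) (axis l 1)"

definition jacT_mult ::
    "nat \<Rightarrow> (real ^ 'n \<Rightarrow> nat \<Rightarrow> real) \<Rightarrow> real ^ 'n \<Rightarrow> (nat \<Rightarrow> real) \<Rightarrow> real ^ 'n"
  where "jacT_mult m h x v = (\<chi> l. \<Sum>i<m. jac h x i l * v i)"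

definition feasible :: "nat \<Rightarrow> (nat \<Rightarrow> nat) \<Rightarrow> (nat \<Rightarrow> real ^ 'n \<Rightarrow> nat \<Rightarrow> real) \<Rightarrow> (real ^ 'n) set"
  where "feasible q m g = {x. \<forall>j\<in>{1..q}. g j x \<in> soc (m j)}"

definition I0 :: "nat \<Rightarrow> (nat \<Rightarrow> real ^ 'n \<Rightarrow> nat \<Rightarrow> real) \<Rightarrow> real ^ 'n \<Rightarrow> nat set"
  where "I0 q g x = {j \<in> {1..q}. g j x = (\<lambda>_. 0)}"

definition IB ::
    "nat \<Rightarrow> (nat \<Rightarrow> nat) \<Rightarrow> (nat \<Rightarrow> real ^ 'n \<Rightarrow> nat \<Rightarrow> real) \<Rightarrow> real ^ 'n \<Rightarrow> nat set"
  where "IB q m g x = {j \<in> {1..q}. g j x \<in> bd_plus (m j)}"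

definition lin_dep :: "'i set \<Rightarrow> ('i \<Rightarrow> 'v::real_vector) \<Rightarrow> bool"
  where "lin_dep S v \<longleftrightarrow> (\<exists>c. (\<exists>i\<in>S. c i \<noteq> 0) \<and> (\<Sum>i\<in>S. c i *\<^sub>R v i) = 0)"

definition pos_lin_dep :: "'i set \<Rightarrow> ('i \<Rightarrow> 'v::real_vector) \<Rightarrow> bool"
  where "pos_lin_dep S v \<longleftrightarrow>
    (\<exists>c. (\<forall>i\<in>S. c i \<ge> 0) \<and> (\<exists>i\<in>S. c i \<noteq> 0) \<and> (\<Sum>i\<in>S. c i *\<^sub>R v i) = 0)"

text \<open>The family \<open>\<D>\<close> for \<open>J\<^sub>B, J\<^sub>-, J\<^sub>+\<close> is indexed by the disjoint sum
  \<open>JB <+> (Jm <+> Jp)\<close>, so that repeated vectors count with multiplicity and an index may belong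
  to several of the three sets.\<close>

definition Dfam ::
    "(nat \<Rightarrow> nat) \<Rightarrow> (nat \<Rightarrow> real ^ 'n \<Rightarrow> nat \<Rightarrow> real) \<Rightarrow> real ^ 'n \<Rightarrow> (nat \<Rightarrow> nat \<Rightarrow> real)
      \<Rightarrow> nat + nat + nat \<Rightarrow> real ^ 'n"
  where "Dfam m g x w = case_sum
    (\<lambda>j. jacT_mult (m j) (g j) x (eigvec1 (normalize_hat (m j) (g j x))))
    (case_sum
      (\<lambda>j. jacT_mult (m j) (g j) x (case_nat 1 (\<lambda>l. - w j l)))
      (\<lambda>j. jacT_mult (m j) (g j) x (case_nat 1 (w j))))"

text \<open>The common shape of seq-CRCQ and seq-CPLD, which differ only in the notion \<open>dep\<close> of
  dependence required at \<open>xb\<close>. The vectors \<open>\<Delta>\<^sub>j\<^sup>k\<close> and \<open>w\<^sub>j\<^sup>k\<close> are \<open>\<Delta> k j\<close> and \<open>w k j\<close>; limits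
  along \<open>k \<in> I\<close> are taken with respect to the filter \<open>inf sequentially (principal I)\<close>.\<close>

definition seq_CQ ::
    "((nat + nat + nat) set \<Rightarrow> (nat + nat + nat \<Rightarrow> real ^ 'n) \<Rightarrow> bool) \<Rightarrow>
     nat \<Rightarrow> (nat \<Rightarrow> nat) \<Rightarrow> (nat \<Rightarrow> real ^ 'n \<Rightarrow> nat \<Rightarrow> real) \<Rightarrow> real ^ 'n \<Rightarrow> bool"
  where "seq_CQ dep q m g xb \<longleftrightarrow>
    (\<forall>(X :: nat \<Rightarrow> real ^ 'n) (\<Delta> :: nat \<Rightarrow> nat \<Rightarrow> nat \<Rightarrow> real).
      X \<longlonglongrightarrow> xb \<and>
      (\<forall>j \<in> I0 q g xb \<union> IB q m g xb.
        (\<forall>k. \<Delta> k j \<in> topspace (Euclidean_space (m j))) \<and>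
        limitin (Euclidean_space (m j)) (\<lambda>k. \<Delta> k j) (\<lambda>_. 0) sequentially)
      \<longrightarrow>
      (\<exists>(I :: nat set) (w :: nat \<Rightarrow> nat \<Rightarrow> nat \<Rightarrow> real) (wb :: nat \<Rightarrow> nat \<Rightarrow> real).
        infinite I \<and>
        (\<forall>j \<in> I0 q g xb.
          (\<forall>k\<in>I. eig_dir (m j) (\<lambda>i. g j (X k) i + \<Delta> k j i) (w k j)) \<and>
          unit_vec (m j - 1) (wb j) \<and>
          limitin (Euclidean_space (m j)) (\<lambda>k. eigvec1 (w k j)) (eigvec1 (wb j))
            (inf sequentially (principal I)) \<and>
          limitin (Euclidean_space (m j)) (\<lambda>k. eigvec2 (w k j)) (eigvec2 (wb j))
            (inf sequentially (principal I))) \<and>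
        (\<forall>JB Jm Jp. JB \<subseteq> IB q m g xb \<and> Jm \<subseteq> I0 q g xb \<and> Jp \<subseteq> I0 q g xb \<longrightarrow>
          dep (JB <+> (Jm <+> Jp)) (Dfam m g xb wb) \<longrightarrow>
          (\<forall>\<^sub>F k in inf sequentially (principal I).
            lin_dep (JB <+> (Jm <+> Jp)) (Dfam m g (X k) (w k))))))"

definition seq_CRCQ ::
    "nat \<Rightarrow> (nat \<Rightarrow> nat) \<Rightarrow> (nat \<Rightarrow> real ^ 'n \<Rightarrow> nat \<Rightarrow> real) \<Rightarrow> real ^ 'n \<Rightarrow> bool"
  where "seq_CRCQ = seq_CQ lin_dep"

definition seq_CPLD ::
    "nat \<Rightarrow> (nat \<Rightarrow> nat) \<Rightarrow> (nat \<Rightarrow> real ^ 'n \<Rightarrow> nat \<Rightarrow> real) \<Rightarrow> real ^ 'n \<Rightarrow> bool"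
  where "seq_CPLD = seq_CQ pos_lin_dep"

text \<open>Distance from \<open>(y\<^sub>1, \<dots>, y\<^sub>q)\<close> to the product of the cones, in the Euclidean norm of the
  product space.\<close>

definition dist_cones :: "nat \<Rightarrow> (nat \<Rightarrow> nat) \<Rightarrow> (nat \<Rightarrow> nat \<Rightarrow> real) \<Rightarrow> real"
  where "dist_cones q m y =
    (INF z \<in> (\<Pi>\<^sub>E j\<in>{1..q}. soc (m j)). L2_set (\<lambda>j. enorm (m j) (\<lambda>i. y j i - z j i)) {1..q})"

definition MSCQ ::
    "nat \<Rightarrow> (nat \<Rightarrow> nat) \<Rightarrow> (nat \<Rightarrow> real ^ 'n \<Rightarrow> nat \<Rightarrow> real) \<Rightarrow> real ^ 'n \<Rightarrow> bool"
  where "MSCQ q m g xb \<longleftrightarrow>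
    (\<exists>\<gamma>>0. \<exists>V. open V \<and> xb \<in> V \<and>
      (\<forall>x\<in>V. infdist x (feasible q m g) \<le> \<gamma> * dist_cones q m (\<lambda>j. g j x)))"

end

theory Submission
  imports Defs
begin

text \<open>
  Two observations carry the proof.

  First, at an index with \<open>g\<^sub>j(x) = 0\<close> the perturbations \<open>\<Delta>\<close> can produce any sequence
  of unit vectors as eigenvector directions. Both sequential conditions therefore amount to one local
  condition (\<open>local_CQ\<close>, lemmas \<open>seq_CQ_imp_local_CQ\<close> and \<open>local_CQ_imp_seq_CQ\<close>): if a
  family at \<open>(x, wb)\<close> is dependent, then so are the families at all \<open>(x', w)\<close> near
  \<open>(x, wb)\<close> with unit vectors \<open>w\<close>. Seq-CRCQ and seq-CPLD differ only in the closed cone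
  \<open>K\<close> of admissible coefficients, \<open>UNIV\<close> or \<open>{0..}\<close>. Compactness of the unit spheres and
  closedness of dependence make the condition uniform (\<open>local_CQ_uniform\<close>). Persistence
  follows (\<open>local_CQ_persists\<close>): near \<open>xb\<close>, an active index either keeps its type or moves
  from \<open>g\<^sub>j = 0\<close> to the boundary, where its vector is half of a vector that the families of
  \<open>xb\<close> contain.

  Second, independent subfamilies near \<open>xb\<close> have uniformly bounded coefficients, in the sense that
  \<open>\<epsilon> * (\<Sum>s. c s) \<le> \<parallel>\<Sum>s. c s *\<^sub>R D s\<parallel>\<close> for nonnegative \<open>c\<close>
  (\<open>local_CQ_coefficient_bound\<close>); otherwise normalised coefficients would converge to a positive
  dependence at \<open>xb\<close>, which forces dependence nearby. For metric subregularity, write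
  \<open>L\<close> for the product of the cones and let \<open>z\<close> minimise \<open>\<parallel>z - x\<parallel>\<^sup>2 + \<rho> dist(g(z), L)\<^sup>2\<close> locally. Stationarity
  (\<open>penalty_stationary\<close>) exhibits \<open>z - x\<close> as a conic combination of vectors
  \<open>Dg\<^sub>j(z)\<^sup>T u\<close>, where \<open>u\<close> is an eigenvector of \<open>g\<^sub>j(z)\<close> with negative eigenvalue.
  Caratheodory's reduction and the coefficient bound give coefficients of order
  \<open>\<parallel>z - x\<parallel>\<close>. As \<open>u\<close> lies in the self-dual cone and \<open>u \<bullet> g\<^sub>j(z) \<le> 0\<close>, each
  \<open>Dg\<^sub>j(z)\<^sup>T u \<bullet> (z - x)\<close> is at most a multiple of \<open>dist(g(x), L)\<close> plus a small multiple of
  \<open>\<parallel>z - x\<parallel>\<close>. Hence \<open>\<parallel>z - x\<parallel> \<le> \<gamma> dist(g(x), L)\<close> uniformly in \<open>\<rho>\<close>, and for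
  \<open>\<rho> \<rightarrow> \<infinity>\<close> the minimisers accumulate at a feasible point.
\<close>

section \<open>Subsequences and radii\<close>

text \<open>The coordinates are extracted one after the other.\<close>

lemma bounded_family_subseq:
  fixes a :: "nat \<Rightarrow> 'p \<Rightarrow> real"
  assumes "finite P" and "\<And>k p. p \<in> P \<Longrightarrow> \<bar>a k p\<bar> \<le> B"
  shows "\<exists>r l. strict_mono (r :: nat \<Rightarrow> nat) \<and> (\<forall>p\<in>P. (\<lambda>k. a (r k) p) \<longlonglongrightarrow> l p)"
  using assms
proof (induction P rule: finite_induct)
  case empty
  then show ?case using strict_mono_id by auto
next
  case (insert x P)
  from insert obtain r l where r: "strict_mono (r :: nat \<Rightarrow> nat)"
    and l: "\<forall>p\<in>P. (\<lambda>k. a (r k) p) \<longlonglongrightarrow> l p" by auto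
  have "bounded (range (\<lambda>k. a (r k) x))"
    by (rule boundedI[of _ B]) (use insert.prems in auto)
  then obtain lx s where s: "strict_mono (s :: nat \<Rightarrow> nat)"
    and lx: "((\<lambda>k. a (r k) x) \<circ> s) \<longlonglongrightarrow> lx"
    using bounded_imp_convergent_subsequence[of "\<lambda>k. a (r k) x"] by metis
  have "(\<lambda>k. a ((r \<circ> s) k) p) \<longlonglongrightarrow> (l(x := lx)) p" if "p \<in> insert x P" for p
  proof (cases "p = x")
    case True
    then show ?thesis using lx by (simp add: o_def)
  next
    case False
    then show ?thesis
      using that l LIMSEQ_subseq_LIMSEQ[OF _ s, of "\<lambda>k. a (r k) p" "l p"] by (simp add: o_def)
  qed
  then show ?case using strict_mono_o[OF r s] by blast
qed

lemma filtermap_subseq: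
  assumes r: "strict_mono (r :: nat \<Rightarrow> nat)"
  shows "filtermap r sequentially = inf sequentially (principal (range r))"
proof (rule filter_eqI)
  fix P
  have "(\<exists>N. \<forall>n\<ge>N. P (r n)) \<longleftrightarrow> (\<exists>N. \<forall>k\<ge>N. k \<in> range r \<longrightarrow> P k)"
  proof
    assume "\<exists>N. \<forall>n\<ge>N. P (r n)"
    then obtain N where "\<forall>n\<ge>N. P (r n)" by blast
    then show "\<exists>N. \<forall>k\<ge>N. k \<in> range r \<longrightarrow> P k"
      using strict_mono_less_eq[OF r] by (intro exI[of _ "r N"]) auto
  next
    assume "\<exists>N. \<forall>k\<ge>N. k \<in> range r \<longrightarrow> P k"
    then obtain N where "\<forall>k\<ge>N. k \<in> range r \<longrightarrow> P k" by blast
    then show "\<exists>N. \<forall>n\<ge>N. P (r n)"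
      using seq_suble[OF r] by (meson order_trans rangeI)
  qed
  then show "eventually P (filtermap r sequentially) \<longleftrightarrow>
      eventually P (inf sequentially (principal (range r)))"
    by (simp add: eventually_filtermap eventually_inf_principal eventually_sequentially)
qed

lemma sequentially_within_infinite:
  assumes "infinite I" shows "inf sequentially (principal I) \<noteq> bot"
proof
  assume "inf sequentially (principal I) = bot"
  then have "eventually (\<lambda>k. k \<notin> I) sequentially"
    by (simp add: trivial_limit_def eventually_inf_principal)
  then have "finite I" by (simp flip: cofinite_eq_sequentially add: eventually_cofinite)
  with assms show False by simp
qed

lemma finite_uniform_radius:
  fixes P :: "real \<Rightarrow> 'a \<Rightarrow> bool"
  assumes "finite A" and "\<And>a. a \<in> A \<Longrightarrow> \<exists>e>0. P e a"
    and mono: "\<And>e e' a. 0 < e' \<Longrightarrow> e' \<le> e \<Longrightarrow> P e a \<Longrightarrow> P e' a"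
  shows "\<exists>e>0. \<forall>a\<in>A. P e a"
  using assms(1,2)
proof (induction A rule: finite_induct)
  case empty
  then show ?case using zero_less_one by blast
next
  case (insert b A)
  obtain e where e: "e > 0" "\<forall>a\<in>A. P e a" using insert by blast
  obtain e' where e': "e' > 0" "P e' b" using insert by blast
  have "\<forall>a\<in>insert b A. P (min e e') a"
    using e e' mono[of "min e e'" e] mono[of "min e e'" e'] by auto
  then show ?case using e e' by (metis min_less_iff_conj)
qed

section \<open>Dependence of indexed families\<close>

text \<open>Linear and positive linear dependence are the two instances \<open>K = UNIV\<close> and
  \<open>K = {0..}\<close> of one notion, in which the coefficients are restricted to a closed cone
  \<open>K\<close> of reals. Closedness and the cone property are what limits and rescaling of families
  require, so both constraint qualifications can be treated at once.\<close>

definition dep_on :: "real set \<Rightarrow> 'i set \<Rightarrow> ('i \<Rightarrow> 'v::real_vector) \<Rightarrow> bool"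
  where "dep_on K S v \<longleftrightarrow>
    (\<exists>c. (\<forall>i\<in>S. c i \<in> K) \<and> (\<exists>i\<in>S. c i \<noteq> 0) \<and> (\<Sum>i\<in>S. c i *\<^sub>R v i) = 0)"

lemma lin_dep_eq_dep_on: "lin_dep = dep_on UNIV"
  by (intro ext) (simp add: lin_dep_def dep_on_def)

lemma pos_lin_dep_eq_dep_on: "pos_lin_dep = dep_on {0..}"
  by (intro ext) (simp add: pos_lin_dep_def dep_on_def)

lemma dep_on_mono: "K \<subseteq> L \<Longrightarrow> dep_on K S v \<Longrightarrow> dep_on L S v"
  unfolding dep_on_def by blast

lemma dep_on_cong: "(\<And>i. i \<in> S \<Longrightarrow> v i = v' i) \<Longrightarrow> dep_on K S v \<longleftrightarrow> dep_on K S v'"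
  unfolding dep_on_def by (metis (mono_tags, lifting) sum.cong)

lemma lin_dep_cong: "(\<And>i. i \<in> S \<Longrightarrow> v i = v' i) \<Longrightarrow> lin_dep S v \<longleftrightarrow> lin_dep S v'"
  unfolding lin_dep_eq_dep_on by (rule dep_on_cong)

lemma dep_on_reindex_scale:
  fixes v :: "'i \<Rightarrow> 'v::real_vector" and v' :: "'j \<Rightarrow> 'v"
  assumes K: "cone K" and inj: "inj_on \<phi> S"
    and t: "\<And>i. i \<in> S \<Longrightarrow> t i > 0" and v': "\<And>i. i \<in> S \<Longrightarrow> v' (\<phi> i) = t i *\<^sub>R v i"
  shows "dep_on K (\<phi> ` S) v' \<longleftrightarrow> dep_on K S v"
proof
  assume "dep_on K (\<phi> ` S) v'"
  then obtain c where c: "\<forall>i\<in>S. c (\<phi> i) \<in> K" "\<exists>i\<in>S. c (\<phi> i) \<noteq> 0"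
    "(\<Sum>i\<in>\<phi> ` S. c i *\<^sub>R v' i) = 0"
    unfolding dep_on_def by auto
  have "(\<Sum>i\<in>S. (t i * c (\<phi> i)) *\<^sub>R v i) = (\<Sum>i\<in>\<phi> ` S. c i *\<^sub>R v' i)"
    using v' by (simp add: sum.reindex[OF inj] mult.commute)
  moreover have "\<forall>i\<in>S. t i * c (\<phi> i) \<in> K"
    using K c(1) t unfolding cone_def by (simp add: less_imp_le)
  moreover have "\<exists>i\<in>S. t i * c (\<phi> i) \<noteq> 0" using c(2) t by force
  ultimately show "dep_on K S v"
    unfolding dep_on_def using c(3) by (intro exI[of _ "\<lambda>i. t i * c (\<phi> i)"]) auto
next
  assume "dep_on K S v"
  then obtain c where c: "\<forall>i\<in>S. c i \<in> K" "\<exists>i\<in>S. c i \<noteq> 0" "(\<Sum>i\<in>S. c i *\<^sub>R v i) = 0"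
    unfolding dep_on_def by auto
  define c' where "c' = (\<lambda>j. let i = the_inv_into S \<phi> j in c i / t i)"
  have c': "c' (\<phi> i) = c i / t i" if "i \<in> S" for i
    using that inj by (simp add: c'_def the_inv_into_f_f)
  have "(\<Sum>i\<in>\<phi> ` S. c' i *\<^sub>R v' i) = (\<Sum>i\<in>S. c i *\<^sub>R v i)"
    using v' c' t by (auto simp: sum.reindex[OF inj] intro!: sum.cong) (metis less_irrefl)
  moreover have "\<forall>i\<in>S. c' (\<phi> i) \<in> K"
  proof
    fix i assume i: "i \<in> S"
    have "(1 / t i) *\<^sub>R c i \<in> K"
      using K c(1) t[OF i] i unfolding cone_def by (metis less_imp_le zero_le_divide_1_iff)
    then show "c' (\<phi> i) \<in> K" using c'[OF i] by simp
  qed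
  moreover have "\<exists>i\<in>S. c' (\<phi> i) \<noteq> 0" using c(2) t c' by force
  ultimately show "dep_on K (\<phi> ` S) v'"
    unfolding dep_on_def using c(3) by (intro exI[of _ c']) auto
qed

text \<open>Normalised coefficients cannot all vanish in the limit.\<close>

lemma dep_on_limit:
  fixes v :: "nat \<Rightarrow> 'i \<Rightarrow> 'v::real_normed_vector"
  assumes S: "finite S" and K: "closed K"
    and cK: "\<And>k i. i \<in> S \<Longrightarrow> c k i \<in> K" and c1: "\<And>k. (\<Sum>i\<in>S. \<bar>c k i\<bar>) = 1"
    and c0: "(\<lambda>k. \<Sum>i\<in>S. c k i *\<^sub>R v k i) \<longlonglongrightarrow> 0"
    and v: "\<And>i. i \<in> S \<Longrightarrow> (\<lambda>k. v k i) \<longlonglongrightarrow> vb i"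
  shows "dep_on K S vb"
proof -
  have "\<bar>c k i\<bar> \<le> 1" if "i \<in> S" for k i
    using member_le_sum[of i S "\<lambda>i. \<bar>c k i\<bar>"] that S c1[of k] by auto
  then have "\<exists>r l. strict_mono (r :: nat \<Rightarrow> nat) \<and> (\<forall>i\<in>S. (\<lambda>k. c (r k) i) \<longlonglongrightarrow> l i)"
    by (intro bounded_family_subseq[OF S]) auto
  then
  obtain r l where r: "strict_mono (r :: nat \<Rightarrow> nat)"
    and l: "\<And>i. i \<in> S \<Longrightarrow> (\<lambda>k. c (r k) i) \<longlonglongrightarrow> l i" by blast
  have vr: "(\<lambda>k. v (r k) i) \<longlonglongrightarrow> vb i" if "i \<in> S" for i
    using LIMSEQ_subseq_LIMSEQ[OF v[OF that] r] by (simp add: o_def)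
  have "(\<lambda>k. \<Sum>i\<in>S. c (r k) i *\<^sub>R v (r k) i) \<longlonglongrightarrow> (\<Sum>i\<in>S. l i *\<^sub>R vb i)"
    by (intro tendsto_sum tendsto_scaleR l vr)
  moreover have "(\<lambda>k. \<Sum>i\<in>S. c (r k) i *\<^sub>R v (r k) i) \<longlonglongrightarrow> 0"
    using LIMSEQ_subseq_LIMSEQ[OF c0 r] by (simp add: o_def)
  ultimately have "(\<Sum>i\<in>S. l i *\<^sub>R vb i) = 0" by (rule LIMSEQ_unique)
  moreover have "l i \<in> K" if "i \<in> S" for i
    using closed_sequentially[OF K _ l[OF that]] cK that by blast
  moreover have "(\<lambda>k. \<Sum>i\<in>S. \<bar>c (r k) i\<bar>) \<longlonglongrightarrow> (\<Sum>i\<in>S. \<bar>l i\<bar>)"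
    by (intro tendsto_sum tendsto_rabs l)
  then have "(\<Sum>i\<in>S. \<bar>l i\<bar>) = 1" by (simp add: c1 LIMSEQ_const_iff)
  then have "\<exists>i\<in>S. l i \<noteq> 0" by (metis abs_0 sum.neutral zero_neq_one)
  ultimately show ?thesis unfolding dep_on_def by blast
qed

lemma dep_on_closed:
  fixes v :: "nat \<Rightarrow> 'i \<Rightarrow> 'v::real_normed_vector"
  assumes S: "finite S" and K: "closed K" "cone K"
    and dep: "\<And>k. dep_on K S (v k)"
    and v: "\<And>i. i \<in> S \<Longrightarrow> (\<lambda>k. v k i) \<longlonglongrightarrow> vb i"
  shows "dep_on K S vb"
proof -
  obtain c where c: "\<And>k i. i \<in> S \<Longrightarrow> c k i \<in> K" "\<And>k. \<exists>i\<in>S. c k i \<noteq> 0"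
    "\<And>k. (\<Sum>i\<in>S. c k i *\<^sub>R v k i) = 0"
    using dep unfolding dep_on_def by metis
  define N where "N k = (\<Sum>i\<in>S. \<bar>c k i\<bar>)" for k
  have N: "N k > 0" for k
    unfolding N_def using c(2)[of k] S by (auto intro: sum_pos2)
  show ?thesis
  proof (rule dep_on_limit[OF S K(1) _ _ _ v])
    fix k i assume "i \<in> S"
    then have "(1 / N k) *\<^sub>R c k i \<in> K"
      using K(2) c(1) N[of k] unfolding cone_def by (metis less_imp_le zero_le_divide_1_iff)
    then show "c k i / N k \<in> K" by simp
  next
    fix k
    have "(\<Sum>i\<in>S. \<bar>c k i / N k\<bar>) = (\<Sum>i\<in>S. \<bar>c k i\<bar>) / N k"
      using N[of k] by (simp add: sum_divide_distrib)
    then show "(\<Sum>i\<in>S. \<bar>c k i / N k\<bar>) = 1" using N[of k] by (simp add: N_def)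
  next
    have "(\<Sum>i\<in>S. (c k i / N k) *\<^sub>R v k i) = (1 / N k) *\<^sub>R (\<Sum>i\<in>S. c k i *\<^sub>R v k i)" for k
      by (simp add: scaleR_sum_right)
    then show "(\<lambda>k. \<Sum>i\<in>S. (c k i / N k) *\<^sub>R v k i) \<longlonglongrightarrow> 0" by (simp add: c(3))
  qed
qed

text \<open>Caratheodory's reduction for conic combinations of an indexed family: along a linear
  dependence relation, the coefficients are moved until the first of them vanishes.\<close>

lemma conic_combination_lin_indep:
  fixes v :: "'i \<Rightarrow> 'v::real_vector"
  assumes "finite S" and "\<And>i. i \<in> S \<Longrightarrow> c i \<ge> 0"
  shows "\<exists>T c'. T \<subseteq> S \<and> (\<forall>i\<in>T. c' i \<ge> 0) \<and> \<not> lin_dep T v \<and>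
    (\<Sum>i\<in>T. c' i *\<^sub>R v i) = (\<Sum>i\<in>S. c i *\<^sub>R v i)"
  using assms
proof (induction "card S" arbitrary: S c rule: less_induct)
  case less
  show ?case
  proof (cases "lin_dep S v")
    case False
    then show ?thesis using less.prems by blast
  next
    case True
    then obtain d0 where d0: "\<exists>i\<in>S. d0 i \<noteq> 0" "(\<Sum>i\<in>S. d0 i *\<^sub>R v i) = 0"
      unfolding lin_dep_def by blast
    obtain d where d: "\<exists>i\<in>S. d i > 0" "(\<Sum>i\<in>S. d i *\<^sub>R v i) = 0"
    proof (cases "\<exists>i\<in>S. d0 i > 0")
      case True
      then show ?thesis using d0 that by blast
    next
      case False
      then have "\<exists>i\<in>S. - d0 i > 0" using d0(1) by force
      moreover have "(\<Sum>i\<in>S. (- d0 i) *\<^sub>R v i) = 0" using d0(2) by (simp add: sum_negf)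
      ultimately show ?thesis using that[of "\<lambda>i. - d0 i"] by blast
    qed
    define P where "P = {i\<in>S. d i > 0}"
    have P: "finite P" "P \<noteq> {}" using less.prems d(1) by (auto simp: P_def)
    then obtain s where s: "s \<in> P" "\<And>i. i \<in> P \<Longrightarrow> c s / d s \<le> c i / d i"
      using arg_min_if_finite[OF P, of "\<lambda>i. c i / d i"] by (meson not_less)
    define t where "t = c s / d s"
    define c' where "c' i = c i - t * d i" for i
    have sS: "s \<in> S" and ds: "d s > 0" using s by (auto simp: P_def)
    have t0: "t \<ge> 0" using less.prems sS ds by (simp add: t_def)
    have c'0: "c' i \<ge> 0" if "i \<in> S" for i
    proof (cases "d i > 0")
      case True
      then have "t \<le> c i / d i" using s(2) that by (simp add: P_def t_def)
      then show ?thesis using True by (simp add: c'_def pos_le_divide_eq)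
    next
      case False
      then have "t * d i \<le> 0" using t0 by (simp add: mult_nonneg_nonpos)
      moreover have "c i \<ge> 0" by (rule less.prems(2)[OF that])
      ultimately show ?thesis unfolding c'_def by linarith
    qed
    have "c' s = 0" using ds by (simp add: c'_def t_def)
    have "(\<Sum>i\<in>S. c' i *\<^sub>R v i) = (\<Sum>i\<in>S. c i *\<^sub>R v i) - t *\<^sub>R (\<Sum>i\<in>S. d i *\<^sub>R v i)"
      by (simp add: c'_def scaleR_diff_left sum_subtractf scaleR_sum_right)
    moreover have "(\<Sum>i\<in>S. c' i *\<^sub>R v i) = (\<Sum>i\<in>S - {s}. c' i *\<^sub>R v i)"
      using less.prems(1) sS \<open>c' s = 0\<close> by (simp add: sum.remove)
    ultimately have eq: "(\<Sum>i\<in>S - {s}. c' i *\<^sub>R v i) = (\<Sum>i\<in>S. c i *\<^sub>R v i)"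
      by (simp add: d(2))
    have "card (S - {s}) < card S" using less.prems(1) sS by (rule card_Diff1_less)
    from less.hyps[OF this, of c'] less.prems(1) c'0 eq show ?thesis
      by (metis DiffD1 Diff_subset finite_Diff subset_trans)
  qed
qed

text \<open>Let \<open>d\<close> be a conic combination of vectors \<open>D s\<close> whose inner products with \<open>d\<close>
  are small. In \<open>\<parallel>d\<parallel>\<^sup>2 = (\<Sum>s. c s * (D s \<bullet> d))\<close> an independent subfamily may be used,
  the coefficients of which are bounded by \<open>\<parallel>d\<parallel>\<close>; dividing by \<open>\<parallel>d\<parallel>\<close> leaves a bound for
  \<open>\<parallel>d\<parallel>\<close> itself, and a small multiple of \<open>\<parallel>d\<parallel>\<close> among the inner products is absorbed.\<close>

lemma displacement_bound:
  assumes \<epsilon>: "\<epsilon> > 0" and S: "finite S"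
    and bound: "\<And>T c. T \<subseteq> S \<Longrightarrow> \<not> lin_dep T D \<Longrightarrow> (\<And>s. s \<in> T \<Longrightarrow> c s \<ge> 0) \<Longrightarrow>
      \<epsilon> * (\<Sum>s\<in>T. c s) \<le> norm (\<Sum>s\<in>T. c s *\<^sub>R D s)"
    and d: "d = (\<Sum>s\<in>S. c s *\<^sub>R D s)" and c: "\<And>s. s \<in> S \<Longrightarrow> c s \<ge> 0"
    and D: "\<And>s. s \<in> S \<Longrightarrow> D s \<bullet> d \<le> N * (L + \<delta> * norm d)"
    and N: "N \<ge> 0" and L: "L \<ge> 0" and \<delta>: "\<delta> \<ge> 0" "2 * N * \<delta> \<le> \<epsilon>"
  shows "\<epsilon> * norm d \<le> 2 * N * L"
proof (cases "d = 0")
  case True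
  then show ?thesis using N L by simp
next
  case False
  have "\<exists>T c'. T \<subseteq> S \<and> (\<forall>s\<in>T. c' s \<ge> 0) \<and> \<not> lin_dep T D \<and>
      (\<Sum>s\<in>T. c' s *\<^sub>R D s) = d"
    unfolding d by (rule conic_combination_lin_indep[OF S]) (rule c)
  then obtain T c' where T: "T \<subseteq> S" "\<forall>s\<in>T. c' s \<ge> 0" "\<not> lin_dep T D"
    "(\<Sum>s\<in>T. c' s *\<^sub>R D s) = d"
    by (elim exE conjE) (rule that)
  let ?B = "N * (L + \<delta> * norm d)"
  have B: "?B \<ge> 0" using N L \<delta> by simp
  have "norm d * norm d = (\<Sum>s\<in>T. c' s *\<^sub>R D s) \<bullet> d"
    by (simp add: T(4) power2_norm_eq_inner flip: power2_eq_square)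
  also have "\<dots> = (\<Sum>s\<in>T. c' s * (D s \<bullet> d))" by (simp add: inner_sum_left)
  also have "\<dots> \<le> (\<Sum>s\<in>T. c' s * ?B)"
    using T D by (intro sum_mono mult_left_mono) auto
  also have "\<dots> = (\<Sum>s\<in>T. c' s) * ?B" by (simp add: sum_distrib_right)
  finally have "\<epsilon> * (norm d * norm d) \<le> (\<epsilon> * (\<Sum>s\<in>T. c' s)) * ?B"
    using \<epsilon> by (simp add: mult.assoc mult_left_mono)
  also have "\<dots> \<le> norm d * ?B"
    using bound[OF T(1,3)] T(2,4) B by (intro mult_right_mono) auto
  finally have "norm d * (\<epsilon> * norm d) \<le> norm d * ?B" by (simp add: mult.left_commute)
  then have "\<epsilon> * norm d \<le> ?B" using False by simp
  also have "2 * ?B = 2 * N * L + (2 * N * \<delta>) * norm d" by (simp add: algebra_simps)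
  moreover have "(2 * N * \<delta>) * norm d \<le> \<epsilon> * norm d" using \<delta>(2) by (rule mult_right_mono) simp
  ultimately show ?thesis by linarith
qed

section \<open>Second-order cones\<close>

lemma limitin_Euclidean_space:
  "limitin (Euclidean_space n) f l F \<longleftrightarrow> l \<in> topspace (Euclidean_space n) \<and>
    (\<forall>\<^sub>F x in F. f x \<in> topspace (Euclidean_space n)) \<and> (\<forall>i. ((\<lambda>x. f x i) \<longlongrightarrow> l i) F)"
  unfolding Euclidean_space_def limitin_subtopology limitin_componentwise by simp

lemma topspace_Euclidean_space_iff:
  "y \<in> topspace (Euclidean_space n) \<longleftrightarrow> (\<forall>i\<ge>n. y i = 0)"
  by (simp add: topspace_Euclidean_space)

lemma hat_in_topspace:
  "y \<in> topspace (Euclidean_space m) \<Longrightarrow> hat y \<in> topspace (Euclidean_space (m - 1))"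
  by (auto simp: topspace_Euclidean_space_iff hat_def)

lemma enorm_nonneg [simp]: "enorm d y \<ge> 0"
  by (simp add: enorm_def L2_set_nonneg)

lemma enorm_sq: "(enorm d y)\<^sup>2 = (\<Sum>i<d. (y i)\<^sup>2)"
  by (simp add: enorm_def L2_set_def sum_nonneg)

lemma enorm_scale: "enorm d (\<lambda>i. a * y i) = \<bar>a\<bar> * enorm d y"
  by (simp add: enorm_def L2_set_def power_mult_distrib real_sqrt_mult flip: sum_distrib_left)

lemma enorm_divide: "enorm d (\<lambda>i. y i / a) = enorm d y / \<bar>a\<bar>"
  using enorm_scale[of d "inverse a" y] by (simp add: divide_inverse mult.commute)

lemma enorm_eq_0_iff:
  assumes "y \<in> topspace (Euclidean_space d)"
  shows "enorm d y = 0 \<longleftrightarrow> y = (\<lambda>_. 0)"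
proof
  assume "enorm d y = 0"
  then have "(\<Sum>i<d. (y i)\<^sup>2) = 0" by (simp flip: enorm_sq)
  then have "\<forall>i<d. y i = 0" by (simp add: sum_nonneg_eq_0_iff)
  then show "y = (\<lambda>_. 0)"
    using assms by (intro ext) (metis topspace_Euclidean_space_iff not_less)
qed (simp add: enorm_def L2_set_def)

lemma abs_le_enorm: "i < d \<Longrightarrow> \<bar>y i\<bar> \<le> enorm d y"
  using member_le_L2_set[of "{..<d}" i "\<lambda>i. \<bar>y i\<bar>"] by (simp add: enorm_def L2_set_def)

lemma enorm_Cauchy_Schwarz: "\<bar>\<Sum>i<d. y i * z i\<bar> \<le> enorm d y * enorm d z"
proof -
  have "\<bar>\<Sum>i<d. y i * z i\<bar> \<le> (\<Sum>i<d. \<bar>y i\<bar> * \<bar>z i\<bar>)"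
    using sum_abs[of "\<lambda>i. y i * z i" "{..<d}"] by (simp add: abs_mult)
  also have "\<dots> \<le> enorm d y * enorm d z" unfolding enorm_def by (rule L2_set_mult_ineq)
  finally show ?thesis .
qed

lemma tendsto_enorm:
  "(\<And>i. i < d \<Longrightarrow> ((\<lambda>x. f x i) \<longlongrightarrow> l i) F) \<Longrightarrow> ((\<lambda>x. enorm d (f x)) \<longlongrightarrow> enorm d l) F"
  unfolding enorm_def L2_set_def by (intro tendsto_intros) auto

lemma unit_vec_abs_le_1: "unit_vec d w \<Longrightarrow> \<bar>w i\<bar> \<le> 1"
  using abs_le_enorm[of i d w]
  by (cases "i < d") (auto simp: unit_vec_def topspace_Euclidean_space_iff)

lemma unit_vec_exists: "d \<ge> 1 \<Longrightarrow> \<exists>w. unit_vec d w"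
proof
  assume d: "d \<ge> 1"
  let ?w = "\<lambda>i. if i = (0::nat) then 1 else 0 :: real"
  have "(\<Sum>i<d. (?w i)\<^sup>2) = (\<Sum>i<d. if i = 0 then 1 else 0)" by (intro sum.cong) auto
  also have "\<dots> = 1" using d by (subst sum.delta) auto
  finally show "unit_vec d ?w"
    using d by (simp add: unit_vec_def enorm_def L2_set_def topspace_Euclidean_space_iff)
qed

lemma unit_vec_normalize_hat:
  assumes "y \<in> topspace (Euclidean_space m)" "hat y \<noteq> (\<lambda>_. 0)"
  shows "unit_vec (m - 1) (normalize_hat m y)"
  using assms hat_in_topspace[OF assms(1)] enorm_eq_0_iff[OF hat_in_topspace[OF assms(1)]]
  by (auto simp: unit_vec_def normalize_hat_def enorm_divide topspace_Euclidean_space_iff)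

lemma eig_dir_exists: "m \<ge> 2 \<Longrightarrow> \<exists>w. eig_dir m y w"
  using unit_vec_exists[of "m - 1"] by (auto simp: eig_dir_def le_diff_conv2)

lemma eig_dir_unit_vec:
  "y \<in> topspace (Euclidean_space m) \<Longrightarrow> eig_dir m y w \<Longrightarrow> unit_vec (m - 1) w"
  using unit_vec_normalize_hat by (auto simp: eig_dir_def split: if_splits)

lemma eig_dir_hat:
  assumes "y \<in> topspace (Euclidean_space m)" "eig_dir m y w"
  shows "hat y i = enorm (m - 1) (hat y) * w i"
proof (cases "hat y = (\<lambda>_. 0)")
  case True
  then have "enorm (m - 1) (hat y) = 0"
    using enorm_eq_0_iff[OF hat_in_topspace[OF assms(1)]] by simp
  with True show ?thesis by simp
next
  case False
  then have "enorm (m - 1) (hat y) \<noteq> 0"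
    using enorm_eq_0_iff[OF hat_in_topspace[OF assms(1)]] by simp
  with False show ?thesis using assms(2) by (simp add: eig_dir_def normalize_hat_def)
qed

lemma inner_case_nat:
  fixes y :: "nat \<Rightarrow> real"
  assumes "m \<ge> 1"
  shows "(\<Sum>i<m. case_nat a v i * y i) = a * y 0 + (\<Sum>i<m - 1. v i * hat y i)"
proof -
  obtain d where "m = Suc d" using assms by (cases m) auto
  then show ?thesis by (simp add: sum.lessThan_Suc_shift hat_def del: sum.lessThan_Suc)
qed

lemma inner_eigvec:
  fixes y :: "nat \<Rightarrow> real"
  assumes "m \<ge> 1"
  shows "(\<Sum>i<m. eigvec1 w i * y i) = (y 0 - (\<Sum>i<m - 1. w i * hat y i)) / 2"
    and "(\<Sum>i<m. eigvec2 w i * y i) = (y 0 + (\<Sum>i<m - 1. w i * hat y i)) / 2"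
proof -
  have "(\<Sum>i<m. eigvec1 w i * y i) = 1/2 * (\<Sum>i<m. case_nat 1 (\<lambda>l. - w l) i * y i)"
    by (simp add: eigvec1_def sum_distrib_left mult.assoc)
  then show "(\<Sum>i<m. eigvec1 w i * y i) = (y 0 - (\<Sum>i<m - 1. w i * hat y i)) / 2"
    by (simp add: inner_case_nat[OF assms] sum_negf)
  have "(\<Sum>i<m. eigvec2 w i * y i) = 1/2 * (\<Sum>i<m. case_nat 1 w i * y i)"
    by (simp add: eigvec2_def sum_distrib_left mult.assoc)
  then show "(\<Sum>i<m. eigvec2 w i * y i) = (y 0 + (\<Sum>i<m - 1. w i * hat y i)) / 2"
    by (simp add: inner_case_nat[OF assms])
qed

lemma inner_eigvec_eig_dir:
  assumes m: "m \<ge> 1" and y: "y \<in> topspace (Euclidean_space m)" and w: "eig_dir m y w"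
  shows "(\<Sum>i<m. eigvec1 w i * y i) = (y 0 - enorm (m - 1) (hat y)) / 2"
    and "(\<Sum>i<m. eigvec2 w i * y i) = (y 0 + enorm (m - 1) (hat y)) / 2"
proof -
  have "(\<Sum>i<m - 1. w i * hat y i) = (\<Sum>i<m - 1. enorm (m - 1) (hat y) * (w i)\<^sup>2)"
    using eig_dir_hat[OF y w] by (intro sum.cong) (simp_all add: power2_eq_square)
  also have "\<dots> = enorm (m - 1) (hat y) * (enorm (m - 1) w)\<^sup>2"
    by (simp add: enorm_sq sum_distrib_left)
  also have "\<dots> = enorm (m - 1) (hat y)"
    using eig_dir_unit_vec[OF y w] by (simp add: unit_vec_def)
  finally have *: "(\<Sum>i<m - 1. w i * hat y i) = enorm (m - 1) (hat y)" .
  show "(\<Sum>i<m. eigvec1 w i * y i) = (y 0 - enorm (m - 1) (hat y)) / 2"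
    "(\<Sum>i<m. eigvec2 w i * y i) = (y 0 + enorm (m - 1) (hat y)) / 2"
    by (simp_all only: inner_eigvec[OF m] *)
qed

text \<open>The eigenvectors lie in the cone, which is self-dual.\<close>

lemma inner_eigvec_soc_nonneg:
  assumes m: "m \<ge> 1" and w: "unit_vec (m - 1) w" and p: "p \<in> soc m"
  shows "(\<Sum>i<m. eigvec1 w i * p i) \<ge> 0" and "(\<Sum>i<m. eigvec2 w i * p i) \<ge> 0"
proof -
  have "\<bar>\<Sum>i<m - 1. w i * hat p i\<bar> \<le> p 0"
    using enorm_Cauchy_Schwarz[of w "hat p" "m - 1"] w p by (auto simp: unit_vec_def soc_def)
  then show "(\<Sum>i<m. eigvec1 w i * p i) \<ge> 0" "(\<Sum>i<m. eigvec2 w i * p i) \<ge> 0"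
    by (auto simp: inner_eigvec[OF m])
qed

text \<open>The squared distance to the cone, in terms of the negative parts of the two
  eigenvalues.\<close>

definition soc_gap :: "nat \<Rightarrow> (nat \<Rightarrow> real) \<Rightarrow> real"
  where "soc_gap m y = ((max 0 (enorm (m - 1) (hat y) - y 0))\<^sup>2
    + (max 0 (- enorm (m - 1) (hat y) - y 0))\<^sup>2) / 2"

lemma soc_gap_nonneg: "soc_gap m y \<ge> 0"
  by (simp add: soc_gap_def)

lemma soc_gap_eq_0_iff:
  assumes "y \<in> topspace (Euclidean_space m)"
  shows "soc_gap m y = 0 \<longleftrightarrow> y \<in> soc m"
proof
  assume "soc_gap m y = 0"
  then have "max 0 (enorm (m - 1) (hat y) - y 0) = 0"
    by (simp add: soc_gap_def add_nonneg_eq_0_iff)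
  then show "y \<in> soc m" using assms by (simp add: soc_def)
next
  assume "y \<in> soc m"
  then have *: "enorm (m - 1) (hat y) \<le> y 0" by (simp add: soc_def)
  have "max 0 (- enorm (m - 1) (hat y) - y 0) = 0" "max 0 (enorm (m - 1) (hat y) - y 0) = 0"
    using * enorm_nonneg[of "m - 1" "hat y"] by linarith+
  then show "soc_gap m y = 0" by (simp only: soc_gap_def) simp
qed

lemma tendsto_soc_gap:
  assumes "\<And>i. ((\<lambda>x. f x i) \<longlongrightarrow> l i) F"
  shows "((\<lambda>x. soc_gap m (f x)) \<longlongrightarrow> soc_gap m l) F"
  unfolding soc_gap_def
  by (intro tendsto_intros tendsto_enorm) (auto simp: hat_def assms)

text \<open>The projection onto the cone replaces the eigenvalues by their positive parts. It is
  optimal because the residual is a nonnegative combination of the negated eigenvectors, hence in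
  the polar cone, and orthogonal to the projection.\<close>

lemma soc_projection:
  assumes m: "m \<ge> 2" and y: "y \<in> topspace (Euclidean_space m)" and w: "eig_dir m y w"
  defines "a \<equiv> max 0 (enorm (m - 1) (hat y) - y 0)"
    and "b \<equiv> max 0 (- enorm (m - 1) (hat y) - y 0)"
  defines "p \<equiv> \<lambda>i. y i + a * eigvec1 w i + b * eigvec2 w i"
  shows "p \<in> soc m" and "(\<Sum>i<m. (y i - p i)\<^sup>2) = soc_gap m y"
    and "p' \<in> soc m \<Longrightarrow> soc_gap m y \<le> (\<Sum>i<m. (y i - p' i)\<^sup>2)"
proof -
  let ?n = "enorm (m - 1) (hat y)"
  have m1: "m \<ge> 1" using m by simp
  have uw: "unit_vec (m - 1) w" by (rule eig_dir_unit_vec[OF y w])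
  have w1: "(\<Sum>i<m - 1. w i * w i) = 1"
    using uw enorm_sq[of "m - 1" w] by (simp add: unit_vec_def power2_eq_square)
  have hp: "hat p = (\<lambda>i. (?n + (b - a) / 2) * w i)"
  proof
    fix i
    have "hat p i = hat y i + (b - a) / 2 * w i"
      by (simp add: hat_def p_def eigvec1_def eigvec2_def field_simps)
    then show "hat p i = (?n + (b - a) / 2) * w i"
      using eig_dir_hat[OF y w, of i] by (simp add: algebra_simps)
  qed
  have p0: "p 0 = y 0 + (a + b) / 2" by (simp add: p_def eigvec1_def eigvec2_def)
  have n0: "?n \<ge> 0" by simp
  have "\<bar>?n + (b - a) / 2\<bar> \<le> p 0"
    using n0 unfolding p0 a_def b_def by (simp add: max_def abs_le_iff field_simps)
  moreover have "enorm (m - 1) w = 1" using uw by (simp add: unit_vec_def)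
  moreover have "p \<in> topspace (Euclidean_space m)"
    using y uw m by (auto simp: topspace_Euclidean_space_iff unit_vec_def p_def eigvec1_def
        eigvec2_def split: nat.splits)
  ultimately show ps: "p \<in> soc m" by (simp add: soc_def hp enorm_scale)
  have e11: "(\<Sum>i<m. eigvec1 w i * eigvec1 w i) = 1/2"
    by (subst inner_eigvec[OF m1]) (simp add: eigvec1_def hat_def w1[simplified] sum_negf flip: sum_divide_distrib)
  have e12: "(\<Sum>i<m. eigvec1 w i * eigvec2 w i) = 0"
    by (subst inner_eigvec[OF m1]) (simp add: eigvec2_def hat_def w1[simplified] sum_negf flip: sum_divide_distrib)
  have e22: "(\<Sum>i<m. eigvec2 w i * eigvec2 w i) = 1/2"
    by (subst inner_eigvec[OF m1]) (simp add: eigvec2_def hat_def w1[simplified] sum_negf flip: sum_divide_distrib)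
  have res: "y i - p i = - (a * eigvec1 w i + b * eigvec2 w i)" for i by (simp add: p_def)
  have "(\<Sum>i<m. (y i - p i)\<^sup>2) = (\<Sum>i<m. a\<^sup>2 * (eigvec1 w i * eigvec1 w i)
      + 2 * a * b * (eigvec1 w i * eigvec2 w i) + b\<^sup>2 * (eigvec2 w i * eigvec2 w i))"
    unfolding res by (intro sum.cong) (auto simp: power2_eq_square algebra_simps)
  also have "\<dots> = (a\<^sup>2 + b\<^sup>2) / 2"
    by (simp add: sum.distrib e11 e12 e22 flip: sum_distrib_left)
  finally show gap: "(\<Sum>i<m. (y i - p i)\<^sup>2) = soc_gap m y"
    by (simp add: soc_gap_def a_def b_def)
  assume p': "p' \<in> soc m"
  have res_inner: "(\<Sum>i<m. (y i - p i) * z i)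
      = - (a * (\<Sum>i<m. eigvec1 w i * z i) + b * (\<Sum>i<m. eigvec2 w i * z i))" for z
    by (simp add: res sum_distrib_left algebra_simps flip: sum_negf sum.distrib)
  have "(\<Sum>i<m - 1. w i * hat p i) = (\<Sum>i<m - 1. (?n + (b - a) / 2) * (w i * w i))"
    unfolding hp by (intro sum.cong) auto
  also have "\<dots> = ?n + (b - a) / 2" by (simp only: w1 mult_1_right flip: sum_distrib_left)
  finally have wp: "(\<Sum>i<m - 1. w i * hat p i) = ?n + (b - a) / 2" .
  have "a * (a - (?n - y 0)) = 0" "b * (b - (- ?n - y 0)) = 0"
    by (auto simp: a_def b_def max_def)
  moreover have "(\<Sum>i<m. eigvec1 w i * p i) = (a - (?n - y 0)) / 2"
    "(\<Sum>i<m. eigvec2 w i * p i) = (b - (- ?n - y 0)) / 2"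
    unfolding inner_eigvec[OF m1] wp p0 by (simp_all add: field_simps)
  ultimately have "a * (\<Sum>i<m. eigvec1 w i * p i) = 0" "b * (\<Sum>i<m. eigvec2 w i * p i) = 0"
    by (simp_all only: times_divide_eq_right)
  then have "(\<Sum>i<m. (y i - p i) * p i) = 0"
    unfolding res_inner by linarith
  moreover have "(\<Sum>i<m. (y i - p i) * p' i) \<le> 0"
    unfolding res_inner neg_le_0_iff_le using inner_eigvec_soc_nonneg[OF m1 uw p']
    by (intro add_nonneg_nonneg mult_nonneg_nonneg) (auto simp: a_def b_def)
  ultimately have orth: "(\<Sum>i<m. (y i - p i) * (p i - p' i)) \<ge> 0"
    by (simp add: right_diff_distrib sum_subtractf)
  have "(\<Sum>i<m. (y i - p' i)\<^sup>2) = (\<Sum>i<m. (y i - p i)\<^sup>2 + 2 * ((y i - p i) * (p i - p' i)) + (p i - p' i)\<^sup>2)"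
    by (intro sum.cong) (auto simp: power2_eq_square algebra_simps)
  also have "\<dots> = soc_gap m y + 2 * (\<Sum>i<m. (y i - p i) * (p i - p' i)) + (\<Sum>i<m. (p i - p' i)\<^sup>2)"
    by (simp add: sum.distrib gap flip: sum_distrib_left)
  finally show "soc_gap m y \<le> (\<Sum>i<m. (y i - p' i)\<^sup>2)"
    using orth sum_nonneg[of "{..<m}" "\<lambda>i. (p i - p' i)\<^sup>2"] by simp
qed

text \<open>Where \<open>y\<^sub>0 = \<parallel>y'\<parallel>\<close>, decreasing \<open>y\<^sub>0\<close> leaves the cone, so such a point is
  not interior.\<close>

lemma bd_plus_iff:
  assumes m: "m \<ge> 1"
  shows "y \<in> bd_plus m \<longleftrightarrow>
    y \<in> topspace (Euclidean_space m) \<and> y \<noteq> (\<lambda>_. 0) \<and> y 0 = enorm (m - 1) (hat y)"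
proof -
  let ?E = "Euclidean_space m"
  let ?h = "\<lambda>y. y 0 - enorm (m - 1) (hat y)"
  have c: "continuous_map ?E euclideanreal (\<lambda>y. y i)" for i
    unfolding Euclidean_space_def
    by (intro continuous_map_from_subtopology continuous_map_product_projection) auto
  have h: "continuous_map ?E euclideanreal ?h"
    unfolding enorm_def L2_set_def hat_def by (intro continuous_intros c) auto
  have soc: "soc m = {y \<in> topspace ?E. ?h y \<in> {0..}}" by (auto simp: soc_def)
  have cl: "closedin ?E (soc m)"
    unfolding soc by (rule closedin_continuous_map_preimage[OF h]) auto
  have op: "openin ?E {y \<in> topspace ?E. ?h y \<in> {0<..}}"
    by (rule openin_continuous_map_preimage[OF h]) auto
  have sub: "{y \<in> topspace ?E. ?h y \<in> {0<..}} \<subseteq> soc m" by (auto simp: soc_def)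
  have int1: "?h y > 0" if y: "y \<in> ?E interior_of soc m"
  proof (rule ccontr)
    assume "\<not> ?h y > 0"
    then have le: "y 0 \<le> enorm (m - 1) (hat y)" by simp
    have yE: "y \<in> topspace ?E" using y interior_of_subset_topspace[of ?E "soc m"] by blast
    define z where "z k = (\<lambda>i. y i - (if i = 0 then 1 / Suc k else 0))" for k
    have hz: "hat (z k) = hat y" for k by (auto simp: z_def hat_def)
    have "limitin ?E z y sequentially"
      unfolding limitin_Euclidean_space
    proof (intro conjI allI)
      show "\<forall>\<^sub>F k in sequentially. z k \<in> topspace ?E"
        using yE m by (simp add: topspace_Euclidean_space_iff z_def)
      have "(\<lambda>k. y i - (if i = 0 then 1 / Suc k else 0)) \<longlonglongrightarrow> y i - (if i = 0 then 0 else 0)" for i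
        using LIMSEQ_inverse_real_of_nat
        by (intro tendsto_diff tendsto_const) (cases "i = 0"; simp add: inverse_eq_divide)
      then show "(\<lambda>k. z k i) \<longlonglongrightarrow> y i" for i by (simp add: z_def)
    qed (rule yE)
    then have "\<forall>\<^sub>F k in sequentially. z k \<in> ?E interior_of soc m"
      using y unfolding limitin_def by auto
    then obtain k where "z k \<in> ?E interior_of soc m"
      using eventually_happens'[OF sequentially_bot] by blast
    then have "z k \<in> soc m" using interior_of_subset[of ?E "soc m"] by blast
    then have "enorm (m - 1) (hat y) \<le> y 0 - 1 / Suc k" by (simp add: soc_def hz) (simp add: z_def)
    moreover have "(0::real) < 1 / Suc k" by simp
    ultimately show False using le by linarith
  qed
  have "y \<in> ?E interior_of soc m \<longleftrightarrow> y \<in> topspace ?E \<and> ?h y > 0"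
    using int1 interior_of_maximal[OF sub op] interior_of_subset_topspace[of ?E "soc m"] by auto
  then show ?thesis
    unfolding bd_plus_def frontier_of_def closure_of_closedin[OF cl] by (auto simp: soc_def)
qed

lemma bd_plus_hat_nonzero:
  assumes m: "m \<ge> 1" and y: "y \<in> bd_plus m"
  shows "hat y \<noteq> (\<lambda>_. 0)" and "y 0 + enorm (m - 1) (hat y) > 0"
proof -
  have yE: "y \<in> topspace (Euclidean_space m)" "y \<noteq> (\<lambda>_. 0)" "y 0 = enorm (m - 1) (hat y)"
    using y bd_plus_iff[OF m] by auto
  show *: "hat y \<noteq> (\<lambda>_. 0)"
  proof
    assume h: "hat y = (\<lambda>_. 0)"
    have "y i = 0" for i
    proof (cases i)
      case 0
      then show ?thesis using h yE(3) by (simp add: enorm_def L2_set_def)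
    next
      case (Suc n)
      then show ?thesis using fun_cong[OF h, of n] by (simp add: hat_def)
    qed
    with yE(2) show False by auto
  qed
  then have "enorm (m - 1) (hat y) \<noteq> 0"
    using enorm_eq_0_iff[OF hat_in_topspace[OF yE(1)]] by simp
  then show "y 0 + enorm (m - 1) (hat y) > 0"
    using yE(3) enorm_nonneg[of "m - 1" "hat y"] by linarith
qed

lemma unit_family_subseq:
  fixes w :: "nat \<Rightarrow> 'j \<Rightarrow> nat \<Rightarrow> real"
  assumes J: "finite J" and w: "\<And>k j. j \<in> J \<Longrightarrow> unit_vec (d j) (w k j)"
  shows "\<exists>r wb. strict_mono (r :: nat \<Rightarrow> nat) \<and>
    (\<forall>j\<in>J. unit_vec (d j) (wb j) \<and> (\<forall>i. (\<lambda>k. w (r k) j i) \<longlonglongrightarrow> wb j i))"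
proof -
  let ?P = "SIGMA j:J. {..<d j}"
  have "finite ?P" using J by auto
  moreover have "\<bar>(\<lambda>(j,i). w k j i) p\<bar> \<le> 1" if "p \<in> ?P" for k p
    using that unit_vec_abs_le_1[OF w] by auto
  ultimately obtain r l where r: "strict_mono (r :: nat \<Rightarrow> nat)"
    and l: "\<forall>p\<in>?P. (\<lambda>k. (\<lambda>(j,i). w (r k) j i) p) \<longlonglongrightarrow> l p"
    using bounded_family_subseq[of ?P "\<lambda>k (j,i). w k j i" 1] by blast
  define wb where "wb j i = (if i < d j then l (j, i) else 0)" for j i
  have lim: "(\<lambda>k. w (r k) j i) \<longlonglongrightarrow> wb j i" if "j \<in> J" for j i
  proof (cases "i < d j")
    case True
    then show ?thesis using l that by (auto simp: wb_def)
  next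
    case False
    then show ?thesis
      using w[OF that] by (simp add: wb_def unit_vec_def topspace_Euclidean_space_iff)
  qed
  have "unit_vec (d j) (wb j)" if "j \<in> J" for j
  proof -
    have "(\<lambda>k. enorm (d j) (w (r k) j)) \<longlonglongrightarrow> enorm (d j) (wb j)"
      by (rule tendsto_enorm) (rule lim[OF that])
    then have "enorm (d j) (wb j) = 1"
      using w[OF that] by (simp add: unit_vec_def LIMSEQ_const_iff)
    then show ?thesis by (simp add: unit_vec_def topspace_Euclidean_space_iff wb_def)
  qed
  with r lim show ?thesis by blast
qed

lemma unit_vec_eventually_close:
  assumes lim: "\<And>i. ((\<lambda>k. w k i) \<longlongrightarrow> wb i) F" and u: "\<forall>\<^sub>F k in F. unit_vec d (w k)"
    and ub: "unit_vec d wb" and \<epsilon>: "\<epsilon> > 0"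
  shows "\<forall>\<^sub>F k in F. \<forall>i. \<bar>wb i - w k i\<bar> < \<epsilon>"
proof -
  have "\<forall>\<^sub>F k in F. \<forall>i\<in>{..<d}. \<bar>wb i - w k i\<bar> < \<epsilon>"
    using tendstoD[OF lim \<epsilon>]
    by (intro eventually_ball_finite) (auto simp: dist_real_def abs_minus_commute)
  with u show ?thesis
  proof eventually_elim
    case (elim k)
    show ?case
    proof
      fix i
      show "\<bar>wb i - w k i\<bar> < \<epsilon>"
        using elim ub \<epsilon> by (cases "i < d") (auto simp: unit_vec_def topspace_Euclidean_space_iff)
    qed
  qed
qed

section \<open>Continuously differentiable functions\<close>

lemma C1_has_derivative:
  assumes "C1 h" shows "(h has_derivative frechet_derivative h (at x)) (at x)"
  using assms unfolding C1_def by (metis differentiableI frechet_derivative_works)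

lemma C1_frechet_derivative_blinfun:
  assumes "C1 h"
  obtains h' where "continuous_on UNIV h'"
    and "\<And>x. frechet_derivative h (at x) = blinfun_apply (h' x)"
proof -
  obtain h' where "\<forall>x. (h has_derivative blinfun_apply (h' x)) (at x)" "continuous_on UNIV h'"
    using assms unfolding C1_def by blast
  then show ?thesis using that frechet_derivative_at by metis
qed

lemma tendsto_C1:
  assumes "C1 h" "(X \<longlongrightarrow> x) F" shows "((\<lambda>k. h (X k)) \<longlongrightarrow> h x) F"
  using has_derivative_continuous[OF C1_has_derivative[OF assms(1)]] assms(2)
  by (rule isCont_tendsto_compose)

lemma tendsto_frechet_derivative_C1:
  assumes "C1 h" "(X \<longlongrightarrow> x) F"
  shows "((\<lambda>k. frechet_derivative h (at (X k)) d) \<longlongrightarrow> frechet_derivative h (at x) d) F"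
proof -
  obtain h' where h': "continuous_on UNIV h'"
    "\<And>x. frechet_derivative h (at x) = blinfun_apply (h' x)"
    using C1_frechet_derivative_blinfun[OF assms(1)] by blast
  have "((\<lambda>k. h' (X k)) \<longlongrightarrow> h' x) F"
    using h'(1) assms(2) by (intro isCont_tendsto_compose[of x h']) (auto simp: continuous_on_eq_continuous_at)
  then show ?thesis unfolding h'(2) by (intro tendsto_intros)
qed

lemma C1_strictly_differentiable:
  fixes h :: "'a::real_normed_vector \<Rightarrow> real"
  assumes h: "C1 h" and \<delta>: "\<delta> > 0"
  shows "\<exists>r>0. \<forall>x\<in>ball xb r. \<forall>z\<in>ball xb r.
    \<bar>h z - h x - frechet_derivative h (at z) (z - x)\<bar> \<le> \<delta> * norm (z - x)"
proof -
  obtain h' where h': "continuous_on UNIV h'"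
    "\<And>x. frechet_derivative h (at x) = blinfun_apply (h' x)"
    using C1_frechet_derivative_blinfun[OF h] by blast
  obtain r where r: "r > 0" "\<And>y. dist y xb < r \<Longrightarrow> dist (h' y) (h' xb) < \<delta> / 2"
    using h'(1) \<delta> unfolding continuous_on_iff by (metis UNIV_I half_gt_zero)
  have "\<bar>h z - h x - frechet_derivative h (at z) (z - x)\<bar> \<le> \<delta> * norm (z - x)"
    if x: "x \<in> ball xb r" and z: "z \<in> ball xb r" for x z
  proof -
    have "norm (h z - h x - blinfun_apply (h' z) (z - x)) \<le> norm (z - x) * \<delta>"
    proof (rule differentiable_bound_linearization[where S = "ball xb r"])
      fix t :: real assume t: "t \<in> {0..1}"
      have "x + t *\<^sub>R (z - x) = (1 - t) *\<^sub>R x + t *\<^sub>R z" by (simp add: algebra_simps)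
      then show "x + t *\<^sub>R (z - x) \<in> ball xb r"
        using convexD_alt[OF convex_ball x z] t by simp
    next
      fix y assume "y \<in> ball xb r"
      show "(h has_derivative blinfun_apply (h' y)) (at y within ball xb r)"
        using C1_has_derivative[OF h, of y] h'(2) by (simp add: has_derivative_at_withinI)
    next
      fix y assume "y \<in> ball xb r"
      then have "dist (h' y) (h' z) < \<delta>"
        using r(2)[of y] r(2)[of z] z dist_triangle_half_l[of "h' y" "h' xb" \<delta> "h' z"]
        by (simp add: dist_commute)
      moreover have "blinfun_apply (h' y) - blinfun_apply (h' z) = blinfun_apply (h' y - h' z)"
        by (simp add: fun_eq_iff blinfun.diff_left)
      ultimately show "onorm (blinfun_apply (h' y) - blinfun_apply (h' z)) \<le> \<delta>"
        by (simp add: dist_norm norm_blinfun.rep_eq)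
    qed (rule z)
    then show ?thesis by (simp add: h'(2) mult.commute)
  qed
  with r(1) show ?thesis by blast
qed

lemma jacT_mult_scale: "jacT_mult m h x (\<lambda>i. a * v i) = a *\<^sub>R jacT_mult m h x v"
  by (simp add: jacT_mult_def vec_eq_iff sum_distrib_left mult.left_commute)

lemma jacT_mult_add:
  "jacT_mult m h x (\<lambda>i. u i + v i) = jacT_mult m h x u + jacT_mult m h x v"
  by (simp add: jacT_mult_def vec_eq_iff distrib_left sum.distrib)

lemma jacT_mult_eigvec:
  "jacT_mult m h x (eigvec1 w) = (1/2) *\<^sub>R jacT_mult m h x (case_nat 1 (\<lambda>l. - w l))"
  "jacT_mult m h x (eigvec2 w) = (1/2) *\<^sub>R jacT_mult m h x (case_nat 1 w)"
  unfolding eigvec1_def eigvec2_def by (rule jacT_mult_scale)+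

section \<open>The constraint system near a point\<close>

lemma sum_subset_decompose:
  assumes "S \<subseteq> A <+> (B <+> C)"
  obtains JB Jm Jp where "JB \<subseteq> A" "Jm \<subseteq> B" "Jp \<subseteq> C" "S = JB <+> (Jm <+> Jp)"
proof
  show "Inl -` S \<subseteq> A" "Inl -` Inr -` S \<subseteq> B" "Inr -` Inr -` S \<subseteq> C"
    using assms by (auto simp: vimage_def)
  show "S = Inl -` S <+> (Inl -` Inr -` S <+> Inr -` Inr -` S)"
  proof (rule set_eqI)
    fix s :: "'a + 'b + 'c"
    consider a where "s = Inl a" | b where "s = Inr (Inl b)" | c where "s = Inr (Inr c)"
      by (metis sumE)
    then show "s \<in> S \<longleftrightarrow> s \<in> Inl -` S <+> (Inl -` Inr -` S <+> Inr -` Inr -` S)"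
      by cases (auto simp: Plus_def)
  qed
qed

locale soc_constraints =
  fixes q :: nat and m :: "nat \<Rightarrow> nat" and g :: "nat \<Rightarrow> real ^ 'n \<Rightarrow> nat \<Rightarrow> real"
  assumes m_ge_2: "j \<in> {1..q} \<Longrightarrow> m j \<ge> 2"
    and g_range: "j \<in> {1..q} \<Longrightarrow> g j x \<in> topspace (Euclidean_space (m j))"
    and g_C1: "j \<in> {1..q} \<Longrightarrow> i < m j \<Longrightarrow> C1 (\<lambda>x. g j x i)"
begin

lemma m_ge_1: "j \<in> {1..q} \<Longrightarrow> m j \<ge> 1"
  using m_ge_2[of j] by linarith

lemma I0_subset: "I0 q g x \<subseteq> {1..q}"
  by (auto simp: I0_def)

lemma IB_subset: "IB q m g x \<subseteq> {1..q}"
  by (auto simp: IB_def)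

lemma finite_I0: "finite (I0 q g x)"
  using finite_subset[OF I0_subset] by blast

lemma finite_IB: "finite (IB q m g x)"
  using finite_subset[OF IB_subset] by blast

lemma I0_IB_disjoint: "I0 q g x \<inter> IB q m g x = {}"
  by (auto simp: I0_def IB_def bd_plus_def)

lemma IB_hat_nonzero:
  assumes "j \<in> IB q m g x"
  shows "hat (g j x) \<noteq> (\<lambda>_. 0)" and "g j x 0 + enorm (m j - 1) (hat (g j x)) > 0"
  using bd_plus_hat_nonzero[of "m j" "g j x"] m_ge_1[of j] assms by (auto simp: IB_def)

lemma tendsto_g:
  assumes "j \<in> {1..q}" "(X \<longlongrightarrow> x) F" shows "((\<lambda>k. g j (X k) i) \<longlongrightarrow> g j x i) F"
proof (cases "i < m j")
  case True
  show ?thesis by (rule tendsto_C1[OF g_C1[OF assms(1) True] assms(2)])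
next
  case False
  then show ?thesis using g_range[OF assms(1)] by (simp add: topspace_Euclidean_space_iff)
qed

lemma tendsto_enorm_hat:
  assumes "j \<in> {1..q}" "(X \<longlongrightarrow> x) F"
  shows "((\<lambda>k. enorm (m j - 1) (hat (g j (X k)))) \<longlongrightarrow> enorm (m j - 1) (hat (g j x))) F"
  by (rule tendsto_enorm) (simp add: hat_def tendsto_g[OF assms])

lemma enorm_hat_eq_0_iff:
  "j \<in> {1..q} \<Longrightarrow> enorm (m j - 1) (hat (g j x)) = 0 \<longleftrightarrow> hat (g j x) = (\<lambda>_. 0)"
  by (intro enorm_eq_0_iff hat_in_topspace g_range)

lemma eventually_hat_nonzero:
  assumes j: "j \<in> {1..q}" and X: "(X \<longlongrightarrow> x) F" and nz: "hat (g j x) \<noteq> (\<lambda>_. 0)"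
  shows "\<forall>\<^sub>F k in F. hat (g j (X k)) \<noteq> (\<lambda>_. 0)"
proof -
  have "enorm (m j - 1) (hat (g j x)) > 0"
    using nz enorm_hat_eq_0_iff[OF j] by (metis enorm_nonneg less_eq_real_def)
  from order_tendstoD(1)[OF tendsto_enorm_hat[OF j X] this]
  show ?thesis by eventually_elim (metis enorm_hat_eq_0_iff[OF j] less_irrefl)
qed

lemma tendsto_normalize_hat:
  assumes j: "j \<in> {1..q}" and X: "(X \<longlongrightarrow> x) F" and nz: "hat (g j x) \<noteq> (\<lambda>_. 0)"
  shows "((\<lambda>k. normalize_hat (m j) (g j (X k)) i) \<longlongrightarrow> normalize_hat (m j) (g j x) i) F"
  unfolding normalize_hat_def
  using nz enorm_hat_eq_0_iff[OF j]
  by (intro tendsto_divide tendsto_enorm_hat[OF j X]) (auto simp: hat_def tendsto_g[OF j X])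

lemma tendsto_jacT_mult:
  assumes j: "j \<in> {1..q}" and X: "(X \<longlongrightarrow> x) F" and v: "\<And>i. ((\<lambda>k. v k i) \<longlongrightarrow> vb i) F"
  shows "((\<lambda>k. jacT_mult (m j) (g j) (X k) (v k)) \<longlongrightarrow> jacT_mult (m j) (g j) x vb) F"
  unfolding jacT_mult_def jac_def
  by (intro tendsto_vec_lambda tendsto_sum tendsto_mult v tendsto_frechet_derivative_C1 X g_C1 j) auto

lemma tendsto_Dfam:
  assumes s: "s \<in> JB <+> (J <+> J)" and J: "JB \<subseteq> {1..q}" "J \<subseteq> {1..q}"
    and X: "(X \<longlongrightarrow> x) F" and nz: "\<And>j. j \<in> JB \<Longrightarrow> hat (g j x) \<noteq> (\<lambda>_. 0)"
    and w: "\<And>j i. j \<in> J \<Longrightarrow> ((\<lambda>k. w k j i) \<longlongrightarrow> wb j i) F"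
  shows "((\<lambda>k. Dfam m g (X k) (w k) s) \<longlongrightarrow> Dfam m g x wb s) F"
proof -
  consider j where "s = Inl j" "j \<in> JB" | j where "s = Inr (Inl j)" "j \<in> J"
    | j where "s = Inr (Inr j)" "j \<in> J"
    using s by auto
  then show ?thesis
  proof cases
    case (1 j)
    then have j: "j \<in> {1..q}" using J by auto
    have "((\<lambda>k. eigvec1 (normalize_hat (m j) (g j (X k))) i)
        \<longlongrightarrow> eigvec1 (normalize_hat (m j) (g j x)) i) F" for i
      unfolding eigvec1_def
      by (cases i) (auto intro!: tendsto_intros tendsto_normalize_hat j X nz 1)
    from tendsto_jacT_mult[OF j X this] show ?thesis by (simp add: Dfam_def 1)
  next
    case (2 j)
    then have j: "j \<in> {1..q}" using J by auto
    have "((\<lambda>k. case_nat 1 (\<lambda>l. - w k j l) i) \<longlongrightarrow> case_nat 1 (\<lambda>l. - wb j l) i) F" for i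
      by (cases i) (auto intro!: tendsto_intros w 2)
    from tendsto_jacT_mult[OF j X this] show ?thesis by (simp add: Dfam_def 2)
  next
    case (3 j)
    then have j: "j \<in> {1..q}" using J by auto
    have "((\<lambda>k. case_nat 1 (w k j) i) \<longlongrightarrow> case_nat 1 (wb j) i) F" for i
      by (cases i) (auto intro!: tendsto_intros w 3)
    from tendsto_jacT_mult[OF j X this] show ?thesis by (simp add: Dfam_def 3)
  qed
qed

lemma tendsto_Dfam_active:
  assumes "s \<in> IB q m g x <+> (I0 q g x <+> I0 q g x)" and "(X \<longlongrightarrow> x) F"
    and "\<And>j i. j \<in> I0 q g x \<Longrightarrow> ((\<lambda>k. w k j i) \<longlongrightarrow> wb j i) F"
  shows "((\<lambda>k. Dfam m g (X k) (w k) s) \<longlongrightarrow> Dfam m g x wb s) F"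
  using assms(1) IB_subset I0_subset assms(2) IB_hat_nonzero(1) assms(3) by (rule tendsto_Dfam)

lemma Dfam_cong:
  assumes "s \<in> JB <+> (J <+> J)" and "\<And>j. j \<in> J \<Longrightarrow> w j = w' j"
  shows "Dfam m g x w s = Dfam m g x w' s"
  using assms by (auto simp: Dfam_def)

lemma active_sets_near:
  assumes xb: "xb \<in> feasible q m g"
  shows "\<forall>\<^sub>F x in nhds xb.
    (\<forall>j\<in>IB q m g xb. hat (g j x) \<noteq> (\<lambda>_. 0) \<and> g j x 0 + enorm (m j - 1) (hat (g j x)) > 0) \<and>
    (\<forall>j\<in>{1..q} - (I0 q g xb \<union> IB q m g xb). enorm (m j - 1) (hat (g j x)) < g j x 0)"
proof -
  have id: "((\<lambda>x. x) \<longlongrightarrow> xb) (nhds xb)" by (rule filterlim_ident)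
  have "\<forall>\<^sub>F x in nhds xb. hat (g j x) \<noteq> (\<lambda>_. 0) \<and> g j x 0 + enorm (m j - 1) (hat (g j x)) > 0"
    if "j \<in> IB q m g xb" for j
  proof -
    have j: "j \<in> {1..q}" using that IB_subset by blast
    show ?thesis
      using eventually_hat_nonzero[OF j id IB_hat_nonzero(1)[OF that]]
        order_tendstoD(1)[OF tendsto_add[OF tendsto_g[OF j id] tendsto_enorm_hat[OF j id]]
          IB_hat_nonzero(2)[OF that]]
      by eventually_elim simp
  qed
  moreover have "\<forall>\<^sub>F x in nhds xb. enorm (m j - 1) (hat (g j x)) < g j x 0"
    if "j \<in> {1..q} - (I0 q g xb \<union> IB q m g xb)" for j
  proof -
    have j: "j \<in> {1..q}" using that by auto
    then have "g j xb \<in> soc (m j)" using xb by (auto simp: feasible_def)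
    then have "enorm (m j - 1) (hat (g j xb)) \<le> g j xb 0" by (simp add: soc_def)
    moreover have "enorm (m j - 1) (hat (g j xb)) \<noteq> g j xb 0"
      using that bd_plus_iff[OF m_ge_1[OF j], of "g j xb"] g_range[OF j]
      by (auto simp: I0_def IB_def)
    ultimately have "g j xb 0 - enorm (m j - 1) (hat (g j xb)) > 0" by simp
    from order_tendstoD(1)[OF tendsto_diff[OF tendsto_g[OF j id] tendsto_enorm_hat[OF j id]] this]
    show ?thesis by eventually_elim simp
  qed
  ultimately show ?thesis
    by (intro eventually_conj[OF eventually_ball_finite eventually_ball_finite] finite_IB ballI) auto
qed

section \<open>The constraint qualifications without eigenvectors\<close>

text \<open>The perturbations \<open>\<Delta>\<close> tend to zero freely, so at an index with \<open>g\<^sub>j(x) = 0\<close> they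
  realise every sequence of unit vectors as eigenvector directions. The sequential condition
  therefore is a continuity property of dependence, in the point and in arbitrary unit vectors,
  in which neither perturbations nor subsequences occur.\<close>

definition local_CQ :: "real set \<Rightarrow> real ^ 'n \<Rightarrow> bool"
  where "local_CQ K x \<longleftrightarrow> (\<forall>S X w wb.
    S \<subseteq> IB q m g x <+> (I0 q g x <+> I0 q g x) \<longrightarrow> X \<longlonglongrightarrow> x \<longrightarrow>
    (\<forall>j\<in>I0 q g x. (\<forall>k. unit_vec (m j - 1) (w k j)) \<and> unit_vec (m j - 1) (wb j) \<and>
      (\<forall>i. (\<lambda>k. w k j i) \<longlonglongrightarrow> wb j i)) \<longrightarrow>
    dep_on K S (Dfam m g x wb) \<longrightarrow>
    (\<forall>\<^sub>F k in sequentially. lin_dep S (Dfam m g (X k) (w k))))"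

lemma local_CQ_I:
  assumes "\<And>S X w wb. S \<subseteq> IB q m g x <+> (I0 q g x <+> I0 q g x) \<Longrightarrow> X \<longlonglongrightarrow> x \<Longrightarrow>
    (\<And>j k. j \<in> I0 q g x \<Longrightarrow> unit_vec (m j - 1) (w k j)) \<Longrightarrow>
    (\<And>j. j \<in> I0 q g x \<Longrightarrow> unit_vec (m j - 1) (wb j)) \<Longrightarrow>
    (\<And>j i. j \<in> I0 q g x \<Longrightarrow> (\<lambda>k. w k j i) \<longlonglongrightarrow> wb j i) \<Longrightarrow>
    dep_on K S (Dfam m g x wb) \<Longrightarrow>
    \<forall>\<^sub>F k in sequentially. lin_dep S (Dfam m g (X k) (w k))"
  shows "local_CQ K x"
  unfolding local_CQ_def by (intro allI impI, rule assms) auto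

lemma local_CQ_D:
  assumes "local_CQ K x" "S \<subseteq> IB q m g x <+> (I0 q g x <+> I0 q g x)" "X \<longlonglongrightarrow> x"
    "\<And>j k. j \<in> I0 q g x \<Longrightarrow> unit_vec (m j - 1) (w k j)"
    "\<And>j. j \<in> I0 q g x \<Longrightarrow> unit_vec (m j - 1) (wb j)"
    "\<And>j i. j \<in> I0 q g x \<Longrightarrow> (\<lambda>k. w k j i) \<longlonglongrightarrow> wb j i"
    "dep_on K S (Dfam m g x wb)"
  shows "\<forall>\<^sub>F k in sequentially. lin_dep S (Dfam m g (X k) (w k))"
  using assms(1)[unfolded local_CQ_def, THEN spec[of _ S], THEN spec[of _ X], THEN spec[of _ w],
      THEN spec[of _ wb]] assms(2-)
  by simp

lemma local_CQ_mono:
  assumes "K \<subseteq> L" "local_CQ L x" shows "local_CQ K x"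
proof (rule local_CQ_I)
  fix S X w wb
  assume *: "S \<subseteq> IB q m g x <+> (I0 q g x <+> I0 q g x)" "X \<longlonglongrightarrow> x"
    "\<And>j k. j \<in> I0 q g x \<Longrightarrow> unit_vec (m j - 1) (w k j)"
    "\<And>j. j \<in> I0 q g x \<Longrightarrow> unit_vec (m j - 1) (wb j)"
    "\<And>j i. j \<in> I0 q g x \<Longrightarrow> (\<lambda>k. w k j i) \<longlonglongrightarrow> wb j i"
    "dep_on K S (Dfam m g x wb)"
  show "\<forall>\<^sub>F k in sequentially. lin_dep S (Dfam m g (X k) (w k))"
    by (rule local_CQ_D[OF assms(2) *(1-5) dep_on_mono[OF assms(1) *(6)]])
qed

text \<open>A violating sequence is turned into an admissible one with
  \<open>g\<^sub>j(x\<^sup>k) + \<Delta>\<^sub>j\<^sup>k = (0, w\<^sub>j\<^sup>k) / (k + 1)\<close>, whose eigenvectors are forced to be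
  those given by \<open>w\<^sub>j\<^sup>k\<close>.\<close>

lemma seq_CQ_imp_local_CQ:
  assumes cq: "seq_CQ (dep_on K) q m g x"
  shows "local_CQ K x"
proof (rule local_CQ_I)
  fix S X w wb
  assume S: "S \<subseteq> IB q m g x <+> (I0 q g x <+> I0 q g x)" and X: "X \<longlonglongrightarrow> x"
    and w: "\<And>j k. j \<in> I0 q g x \<Longrightarrow> unit_vec (m j - 1) (w k j)"
    and wlim: "\<And>j i. j \<in> I0 q g x \<Longrightarrow> (\<lambda>k. w k j i) \<longlonglongrightarrow> wb j i"
    and dep: "dep_on K S (Dfam m g x wb)"
  show "\<forall>\<^sub>F k in sequentially. lin_dep S (Dfam m g (X k) (w k))"
  proof (rule ccontr)
    assume "\<not> (\<forall>\<^sub>F k in sequentially. lin_dep S (Dfam m g (X k) (w k)))"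
    then have "infinite {k. \<not> lin_dep S (Dfam m g (X k) (w k))}"
      by (simp flip: cofinite_eq_sequentially add: eventually_cofinite)
    then obtain r where r: "strict_mono (r :: nat \<Rightarrow> nat)"
      and indep: "\<And>k. \<not> lin_dep S (Dfam m g (X (r k)) (w (r k)))"
      using infinite_enumerate by (metis (no_types, lifting) mem_Collect_eq)
    define \<Delta> where "\<Delta> k j = (\<lambda>i. if j \<in> I0 q g x
      then case_nat 0 (\<lambda>l. w (r k) j l / Suc k) i - g j (X (r k)) i else 0)" for k j
    have Xr: "(\<lambda>k. X (r k)) \<longlonglongrightarrow> x"
      using LIMSEQ_subseq_LIMSEQ[OF X r] by (simp add: o_def)
    have \<Delta>E: "\<Delta> k j \<in> topspace (Euclidean_space (m j))" if "j \<in> I0 q g x \<union> IB q m g x" for k j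
    proof -
      have j: "j \<in> {1..q}" using that I0_subset IB_subset by blast
      show ?thesis
        using w[of j "r k"] g_range[OF j] m_ge_2[OF j]
        by (auto simp: \<Delta>_def topspace_Euclidean_space_iff unit_vec_def split: nat.splits)
    qed
    moreover have "limitin (Euclidean_space (m j)) (\<lambda>k. \<Delta> k j) (\<lambda>_. 0) sequentially"
      if "j \<in> I0 q g x \<union> IB q m g x" for j
    proof (cases "j \<in> I0 q g x")
      case True
      then have j: "j \<in> {1..q}" using I0_subset by blast
      have "(\<lambda>k. case_nat 0 (\<lambda>l. w (r k) j l / Suc k) i) \<longlonglongrightarrow> 0" for i
      proof (rule Lim_null_comparison)
        show "\<forall>\<^sub>F k in sequentially. norm (case_nat 0 (\<lambda>l. w (r k) j l / Suc k) i) \<le> inverse (Suc k)"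
          using unit_vec_abs_le_1[OF w[OF True]]
          by (cases i) (auto simp: inverse_eq_divide divide_right_mono intro!: always_eventually)
      qed (rule LIMSEQ_inverse_real_of_nat)
      moreover have "(\<lambda>k. g j (X (r k)) i) \<longlonglongrightarrow> 0" for i
        using tendsto_g[OF j Xr, of i] True by (simp add: I0_def)
      ultimately have "(\<lambda>k. \<Delta> k j i) \<longlonglongrightarrow> 0" for i
        using True tendsto_diff by (fastforce simp: \<Delta>_def)
      then show ?thesis
        unfolding limitin_Euclidean_space using \<Delta>E[OF that]
        by (simp add: topspace_Euclidean_space_iff[of "\<lambda>_. 0"])
    next
      case False
      then show ?thesis by (simp add: \<Delta>_def topspace_Euclidean_space_iff)
    qed
    ultimately have "(\<lambda>k. X (r k)) \<longlonglongrightarrow> x \<and> (\<forall>j \<in> I0 q g x \<union> IB q m g x.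
        (\<forall>k. \<Delta> k j \<in> topspace (Euclidean_space (m j))) \<and>
        limitin (Euclidean_space (m j)) (\<lambda>k. \<Delta> k j) (\<lambda>_. 0) sequentially)"
      using Xr by simp
    from cq[unfolded seq_CQ_def, THEN spec[of _ "\<lambda>k. X (r k)"], THEN spec[of _ \<Delta>], THEN mp, OF this]
    obtain I w' wb' where I: "infinite I"
      and eig: "\<forall>j\<in>I0 q g x.
        (\<forall>k\<in>I. eig_dir (m j) (\<lambda>i. g j (X (r k)) i + \<Delta> k j i) (w' k j)) \<and>
        unit_vec (m j - 1) (wb' j) \<and>
        limitin (Euclidean_space (m j)) (\<lambda>k. eigvec1 (w' k j)) (eigvec1 (wb' j))
          (inf sequentially (principal I)) \<and>
        limitin (Euclidean_space (m j)) (\<lambda>k. eigvec2 (w' k j)) (eigvec2 (wb' j))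
          (inf sequentially (principal I))"
      and deps: "\<forall>JB Jm Jp. JB \<subseteq> IB q m g x \<and> Jm \<subseteq> I0 q g x \<and> Jp \<subseteq> I0 q g x \<longrightarrow>
        dep_on K (JB <+> (Jm <+> Jp)) (Dfam m g x wb') \<longrightarrow>
        (\<forall>\<^sub>F k in inf sequentially (principal I).
          lin_dep (JB <+> (Jm <+> Jp)) (Dfam m g (X (r k)) (w' k)))"
      by (elim exE conjE) (rule that)
    have w': "w' k j = w (r k) j" if j0: "j \<in> I0 q g x" and k: "k \<in> I" for j k
    proof -
      have u: "enorm (m j - 1) (w (r k) j) = 1" using w[OF j0] by (simp add: unit_vec_def)
      let ?y = "\<lambda>i. g j (X (r k)) i + \<Delta> k j i"
      have h: "hat ?y = (\<lambda>l. w (r k) j l / Suc k)"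
        using j0 by (simp add: \<Delta>_def hat_def)
      have e: "enorm (m j - 1) (\<lambda>l. w (r k) j l / Suc k) = 1 / Suc k"
        using u unfolding enorm_divide by simp
      have "enorm (m j - 1) (hat ?y) \<noteq> 0" unfolding h e by simp
      then have "hat ?y \<noteq> (\<lambda>_. 0)" by (auto simp: enorm_def L2_set_def)
      with eig j0 k have "w' k j = normalize_hat (m j) ?y" by (simp add: eig_dir_def)
      also have "\<dots> = w (r k) j" unfolding normalize_hat_def h e by auto
      finally show ?thesis .
    qed
    have wb': "wb' j = wb j" if j0: "j \<in> I0 q g x" for j
    proof
      fix l
      let ?F = "inf sequentially (principal I)"
      have "((\<lambda>k. eigvec2 (w' k j) (Suc l)) \<longlongrightarrow> eigvec2 (wb' j) (Suc l)) ?F"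
        using eig j0 by (simp add: limitin_Euclidean_space)
      then have "((\<lambda>k. 2 * eigvec2 (w' k j) (Suc l)) \<longlongrightarrow> 2 * eigvec2 (wb' j) (Suc l)) ?F"
        by (intro tendsto_intros)
      then have 1: "((\<lambda>k. w' k j l) \<longlongrightarrow> wb' j l) ?F" by (simp add: eigvec2_def)
      have "(\<lambda>k. w (r k) j l) \<longlonglongrightarrow> wb j l"
        using LIMSEQ_subseq_LIMSEQ[OF wlim[OF j0] r] by (simp add: o_def)
      then have "((\<lambda>k. w (r k) j l) \<longlongrightarrow> wb j l) ?F"
        by (rule tendsto_mono[rotated]) simp
      moreover have "\<forall>\<^sub>F k in ?F. w (r k) j l = w' k j l"
        using w'[OF j0] by (simp add: eventually_inf_principal)
      ultimately have 2: "((\<lambda>k. w' k j l) \<longlongrightarrow> wb j l) ?F" by (rule Lim_transform_eventually)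
      show "wb' j l = wb j l"
        by (rule tendsto_unique[OF sequentially_within_infinite[OF I] 1 2])
    qed
    obtain JB Jm Jp where J: "JB \<subseteq> IB q m g x" "Jm \<subseteq> I0 q g x" "Jp \<subseteq> I0 q g x"
      "S = JB <+> (Jm <+> Jp)"
      using sum_subset_decompose[OF S] by blast
    have "dep_on K S (Dfam m g x wb')"
      using dep dep_on_cong[of S "Dfam m g x wb'" "Dfam m g x wb" K] Dfam_cong[OF subsetD[OF S]] wb'
      by blast
    then have "\<forall>\<^sub>F k in inf sequentially (principal I). lin_dep S (Dfam m g (X (r k)) (w' k))"
      using deps J by simp
    moreover have "\<forall>\<^sub>F k in inf sequentially (principal I). k \<in> I"
      by (simp add: eventually_inf_principal)
    ultimately have "\<forall>\<^sub>F k in inf sequentially (principal I).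
        k \<in> I \<and> lin_dep S (Dfam m g (X (r k)) (w' k))"
      by eventually_elim simp
    then obtain k where k: "k \<in> I" "lin_dep S (Dfam m g (X (r k)) (w' k))"
      using eventually_happens'[OF sequentially_within_infinite[OF I]] by blast
    then have "lin_dep S (Dfam m g (X (r k)) (w (r k)))"
      using lin_dep_cong[of S "Dfam m g (X (r k)) (w' k)"] Dfam_cong[OF subsetD[OF S]] w' by blast
    with indep show False by blast
  qed
qed

lemma local_CQ_imp_seq_CQ:
  assumes cq: "local_CQ K x"
  shows "seq_CQ (dep_on K) q m g x"
  unfolding seq_CQ_def
proof (intro allI impI)
  fix X :: "nat \<Rightarrow> real ^ 'n" and \<Delta> :: "nat \<Rightarrow> nat \<Rightarrow> nat \<Rightarrow> real"
  assume asm: "X \<longlonglongrightarrow> x \<and> (\<forall>j\<in>I0 q g x \<union> IB q m g x.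
    (\<forall>k. \<Delta> k j \<in> topspace (Euclidean_space (m j))) \<and>
    limitin (Euclidean_space (m j)) (\<lambda>k. \<Delta> k j) (\<lambda>_. 0) sequentially)"
  define y where "y k j = (\<lambda>i. g j (X k) i + \<Delta> k j i)" for k j
  define w where "w k j = (SOME w. eig_dir (m j) (y k j) w)" for k j
  have w: "eig_dir (m j) (y k j) (w k j)" if "j \<in> I0 q g x" for k j
    unfolding w_def using that I0_subset by (intro someI_ex[OF eig_dir_exists] m_ge_2) blast
  have uw: "unit_vec (m j - 1) (w k j)" if "j \<in> I0 q g x" for k j
  proof (rule eig_dir_unit_vec[OF _ w[OF that]])
    have "j \<in> {1..q}" using that I0_subset by blast
    then show "y k j \<in> topspace (Euclidean_space (m j))"
      using asm that g_range[of j "X k"] by (auto simp: y_def topspace_Euclidean_space_iff)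
  qed
  obtain r wb where r: "strict_mono (r :: nat \<Rightarrow> nat)"
    and wb: "\<And>j. j \<in> I0 q g x \<Longrightarrow> unit_vec (m j - 1) (wb j)"
    and lim: "\<And>j i. j \<in> I0 q g x \<Longrightarrow> (\<lambda>k. w (r k) j i) \<longlonglongrightarrow> wb j i"
    using unit_family_subseq[of "I0 q g x" "\<lambda>j. m j - 1" w, OF finite_I0 uw] by blast
  let ?F = "inf sequentially (principal (range r))"
  have limF: "((\<lambda>k. w k j i) \<longlongrightarrow> wb j i) ?F" if "j \<in> I0 q g x" for j i
    using lim[OF that] by (simp add: filterlim_filtermap flip: filtermap_subseq[OF r])
  have inE: "eigvec1 v \<in> topspace (Euclidean_space (m j)) \<and>
      eigvec2 v \<in> topspace (Euclidean_space (m j))"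
    if "j \<in> I0 q g x" "unit_vec (m j - 1) v" for j v
    using that m_ge_2[of j] I0_subset
    by (fastforce simp: eigvec1_def eigvec2_def unit_vec_def topspace_Euclidean_space_iff
        split: nat.splits)
  have "limitin (Euclidean_space (m j)) (\<lambda>k. eigvec1 (w k j)) (eigvec1 (wb j)) ?F"
    "limitin (Euclidean_space (m j)) (\<lambda>k. eigvec2 (w k j)) (eigvec2 (wb j)) ?F"
    if j: "j \<in> I0 q g x" for j
  proof -
    have "((\<lambda>k. eigvec1 (w k j) i) \<longlongrightarrow> eigvec1 (wb j) i) ?F" for i
      unfolding eigvec1_def by (cases i) (auto intro!: tendsto_intros limF j)
    then show "limitin (Euclidean_space (m j)) (\<lambda>k. eigvec1 (w k j)) (eigvec1 (wb j)) ?F"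
      unfolding limitin_Euclidean_space using inE[OF j] uw[OF j] wb[OF j] by simp
    have "((\<lambda>k. eigvec2 (w k j) i) \<longlongrightarrow> eigvec2 (wb j) i) ?F" for i
      unfolding eigvec2_def by (cases i) (auto intro!: tendsto_intros limF j)
    then show "limitin (Euclidean_space (m j)) (\<lambda>k. eigvec2 (w k j)) (eigvec2 (wb j)) ?F"
      unfolding limitin_Euclidean_space using inE[OF j] uw[OF j] wb[OF j] by simp
  qed
  moreover have "\<forall>\<^sub>F k in ?F. lin_dep S (Dfam m g (X k) (w k))"
    if S: "S \<subseteq> IB q m g x <+> (I0 q g x <+> I0 q g x)" and dep: "dep_on K S (Dfam m g x wb)" for S
  proof -
    have "(\<lambda>k. X (r k)) \<longlonglongrightarrow> x"
      using LIMSEQ_subseq_LIMSEQ[of X x r] asm r by (simp add: o_def)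
    then have "\<forall>\<^sub>F k in sequentially. lin_dep S (Dfam m g (X (r k)) (w (r k)))"
      by (rule local_CQ_D[OF cq S _ uw wb lim dep])
    then show ?thesis by (simp add: eventually_filtermap flip: filtermap_subseq[OF r])
  qed
  moreover have "infinite (range r)"
    using r by (simp add: range_inj_infinite strict_mono_imp_inj_on)
  moreover have "JB <+> (Jm <+> Jp) \<subseteq> IB q m g x <+> (I0 q g x <+> I0 q g x)"
    if "JB \<subseteq> IB q m g x" "Jm \<subseteq> I0 q g x" "Jp \<subseteq> I0 q g x" for JB Jm Jp
    using that by auto
  ultimately show "\<exists>I w wb. infinite I \<and>
        (\<forall>j \<in> I0 q g x.
          (\<forall>k\<in>I. eig_dir (m j) (\<lambda>i. g j (X k) i + \<Delta> k j i) (w k j)) \<and>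
          unit_vec (m j - 1) (wb j) \<and>
          limitin (Euclidean_space (m j)) (\<lambda>k. eigvec1 (w k j)) (eigvec1 (wb j))
            (inf sequentially (principal I)) \<and>
          limitin (Euclidean_space (m j)) (\<lambda>k. eigvec2 (w k j)) (eigvec2 (wb j))
            (inf sequentially (principal I))) \<and>
        (\<forall>JB Jm Jp. JB \<subseteq> IB q m g x \<and> Jm \<subseteq> I0 q g x \<and> Jp \<subseteq> I0 q g x \<longrightarrow>
          dep_on K (JB <+> (Jm <+> Jp)) (Dfam m g x wb) \<longrightarrow>
          (\<forall>\<^sub>F k in inf sequentially (principal I).
            lin_dep (JB <+> (Jm <+> Jp)) (Dfam m g (X k) (w k))))"
    using w wb by (intro exI[of _ "range r"] exI[of _ w] exI[of _ wb]) (auto simp: y_def)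
qed

section \<open>Stability of the constraint qualifications\<close>

text \<open>A form with one radius for all base points: sequences violating it would have a convergent
  subsequence by compactness of the unit spheres, and since dependence is closed under limits the
  limit would violate the condition at \<open>xb\<close>.\<close>

lemma local_CQ_uniform:
  assumes K: "closed K" "cone K" and cq: "local_CQ K xb"
  shows "\<exists>\<epsilon>>0. \<forall>S\<in>Pow (IB q m g xb <+> (I0 q g xb <+> I0 q g xb)). \<forall>x x' w w'.
    dist x xb < \<epsilon> \<longrightarrow> dist x' xb < \<epsilon> \<longrightarrow>
    (\<forall>j\<in>I0 q g xb. unit_vec (m j - 1) (w j) \<and> unit_vec (m j - 1) (w' j) \<and>
      (\<forall>i. \<bar>w j i - w' j i\<bar> < \<epsilon>)) \<longrightarrow>
    dep_on K S (Dfam m g x w) \<longrightarrow> lin_dep S (Dfam m g x' w')"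
    (is "\<exists>\<epsilon>>0. \<forall>S\<in>Pow ?U. ?P \<epsilon> S")
proof (rule finite_uniform_radius)
  show "finite (Pow ?U)" using finite_IB finite_I0 by simp
  show "?P e' S" if "0 < e'" "e' \<le> e" "?P e S" for e e' S
  proof (intro allI impI)
    fix x x' w w'
    assume *: "dist x xb < e'" "dist x' xb < e'"
      "\<forall>j\<in>I0 q g xb. unit_vec (m j - 1) (w j) \<and> unit_vec (m j - 1) (w' j) \<and>
        (\<forall>i. \<bar>w j i - w' j i\<bar> < e')" "dep_on K S (Dfam m g x w)"
    then have "\<forall>j\<in>I0 q g xb. unit_vec (m j - 1) (w j) \<and> unit_vec (m j - 1) (w' j) \<and>
        (\<forall>i. \<bar>w j i - w' j i\<bar> < e)"
      using that(2) by (meson order_less_le_trans)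
    with that(3)[THEN spec[of _ x], THEN spec[of _ x'], THEN spec[of _ w], THEN spec[of _ w']]
    show "lin_dep S (Dfam m g x' w')" using * that(2) by linarith
  qed
  fix S assume "S \<in> Pow ?U"
  then have S: "S \<subseteq> ?U" by simp
  show "\<exists>e>0. ?P e S"
  proof (rule ccontr)
    assume neg: "\<not> (\<exists>e>0. ?P e S)"
    have "\<exists>x x' w w'. dist x xb < 1 / Suc k \<and> dist x' xb < 1 / Suc k \<and>
      (\<forall>j\<in>I0 q g xb. unit_vec (m j - 1) (w j) \<and> unit_vec (m j - 1) (w' j) \<and>
        (\<forall>i. \<bar>w j i - w' j i\<bar> < 1 / Suc k)) \<and>
      dep_on K S (Dfam m g x w) \<and> \<not> lin_dep S (Dfam m g x' w')" for k
    proof -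
      have "\<not> ?P (1 / Suc k) S"
      proof
        assume P: "?P (1 / Suc k) S"
        have "\<exists>e>0. ?P e S" by (rule exI[of _ "1 / Suc k"], rule conjI[OF _ P]) simp
        with neg show False by contradiction
      qed
      then show ?thesis by (simp only: not_all not_imp)
    qed
    then obtain x x' w w' where
      x: "\<And>k. dist (x k) xb < 1 / Suc k" and x': "\<And>k. dist (x' k) xb < 1 / Suc k"
      and w: "\<And>k. \<forall>j\<in>I0 q g xb. unit_vec (m j - 1) (w k j) \<and> unit_vec (m j - 1) (w' k j) \<and>
        (\<forall>i. \<bar>w k j i - w' k j i\<bar> < 1 / Suc k)"
      and dep: "\<And>k. dep_on K S (Dfam m g (x k) (w k))"
      and indep: "\<And>k. \<not> lin_dep S (Dfam m g (x' k) (w' k))"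
      by metis
    have inv: "(\<lambda>k. 1 / real (Suc k)) \<longlonglongrightarrow> 0"
      using LIMSEQ_inverse_real_of_nat by (simp add: inverse_eq_divide)
    have to_xb: "y \<longlonglongrightarrow> xb" if "\<And>k. dist (y k) xb < 1 / Suc k" for y :: "nat \<Rightarrow> real ^ 'n"
      by (rule metric_tendsto_imp_tendsto[OF inv]) (use that in \<open>auto intro!: always_eventually less_imp_le\<close>)
    obtain r wb where r: "strict_mono (r :: nat \<Rightarrow> nat)"
      and wb: "\<And>j. j \<in> I0 q g xb \<Longrightarrow> unit_vec (m j - 1) (wb j)"
      and lim: "\<And>j i. j \<in> I0 q g xb \<Longrightarrow> (\<lambda>k. w (r k) j i) \<longlonglongrightarrow> wb j i"
      using unit_family_subseq[of "I0 q g xb" "\<lambda>j. m j - 1" w, OF finite_I0] w by blast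
    have lim': "(\<lambda>k. w' (r k) j i) \<longlonglongrightarrow> wb j i" if j: "j \<in> I0 q g xb" for j i
    proof (rule Lim_transform[OF lim[OF j]])
      have "(\<lambda>k. w' k j i - w k j i) \<longlonglongrightarrow> 0"
      proof (rule Lim_null_comparison[OF always_eventually inv], rule allI)
        fix k
        have "\<bar>w k j i - w' k j i\<bar> < 1 / Suc k" using w[of k] j by blast
        then show "norm (w' k j i - w k j i) \<le> 1 / Suc k" by (simp add: abs_minus_commute)
      qed
      from LIMSEQ_subseq_LIMSEQ[OF this r]
      show "(\<lambda>k. w' (r k) j i - w (r k) j i) \<longlonglongrightarrow> 0" by (simp add: o_def)
    qed
    have xr: "(\<lambda>k. x (r k)) \<longlonglongrightarrow> xb" "(\<lambda>k. x' (r k)) \<longlonglongrightarrow> xb"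
      using LIMSEQ_subseq_LIMSEQ[OF to_xb[OF x] r] LIMSEQ_subseq_LIMSEQ[OF to_xb[OF x'] r]
      by (simp_all add: o_def)
    have "finite S" using S finite_IB finite_I0 by (auto intro: finite_subset)
    then have "dep_on K S (Dfam m g xb wb)"
      by (rule dep_on_closed[OF _ K dep]) (rule tendsto_Dfam_active[OF subsetD[OF S] xr(1) lim])
    then have "\<forall>\<^sub>F k in sequentially. lin_dep S (Dfam m g (x' (r k)) (w' (r k)))"
      using w wb lim' by (intro local_CQ_D[OF cq S xr(2)]) auto
    then show False using indep by (simp add: eventually_False)
  qed
qed

text \<open>At a point \<open>x\<close> near \<open>xb\<close>, an index that is on the boundary at \<open>x\<close> but zero at
  \<open>xb\<close> contributes to the family of \<open>x\<close> the vector
  \<open>Dg\<^sub>j(x)\<^sup>T u\<^sub>1(g\<^sub>j(x))\<close>, which is half of the vector that the family of \<open>xb\<close>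
  contains for this index and the direction of \<open>g\<^sub>j(x)\<close>. So the families of \<open>x\<close> are, up to
  positive factors and renaming, families of \<open>xb\<close>, and the uniform version applies.\<close>

lemma local_CQ_persists:
  assumes K: "closed K" "cone K" and xb: "xb \<in> feasible q m g" and cq: "local_CQ K xb"
  shows "\<forall>\<^sub>F x in nhds xb. local_CQ K x"
proof -
  from local_CQ_uniform[OF K cq] obtain \<epsilon> where \<epsilon>: "\<epsilon> > 0"
    and *: "\<forall>S\<in>Pow (IB q m g xb <+> (I0 q g xb <+> I0 q g xb)). \<forall>x x' w w'.
      dist x xb < \<epsilon> \<longrightarrow> dist x' xb < \<epsilon> \<longrightarrow>
      (\<forall>j\<in>I0 q g xb. unit_vec (m j - 1) (w j) \<and> unit_vec (m j - 1) (w' j) \<and>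
        (\<forall>i. \<bar>w j i - w' j i\<bar> < \<epsilon>)) \<longrightarrow>
      dep_on K S (Dfam m g x w) \<longrightarrow> lin_dep S (Dfam m g x' w')"
    by (elim exE conjE) (rule that)
  have unif: "lin_dep S (Dfam m g x' w')"
    if "S \<subseteq> IB q m g xb <+> (I0 q g xb <+> I0 q g xb)" "dist x xb < \<epsilon>" "dist x' xb < \<epsilon>"
      "\<And>j. j \<in> I0 q g xb \<Longrightarrow> unit_vec (m j - 1) (w j) \<and> unit_vec (m j - 1) (w' j) \<and>
        (\<forall>i. \<bar>w j i - w' j i\<bar> < \<epsilon>)"
      "dep_on K S (Dfam m g x w)" for S x x' w w'
    using *[THEN bspec, OF PowI, OF that(1), THEN spec[of _ x], THEN spec[of _ x'],
        THEN spec[of _ w], THEN spec[of _ w']] that by simp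
  have "\<forall>\<^sub>F x in nhds xb. dist x xb < \<epsilon>"
    using \<epsilon> by (auto simp: eventually_nhds_metric)
  with active_sets_near[OF xb] show ?thesis
  proof eventually_elim
    case (elim x)
    then have near_B: "\<And>j. j \<in> IB q m g xb \<Longrightarrow> hat (g j x) \<noteq> (\<lambda>_. 0)"
      and near_int: "\<And>j. j \<in> {1..q} \<Longrightarrow> j \<notin> I0 q g xb \<Longrightarrow> j \<notin> IB q m g xb \<Longrightarrow>
        enorm (m j - 1) (hat (g j x)) < g j x 0"
      and x: "dist x xb < \<epsilon>" by auto
    have I0: "j \<in> I0 q g xb" if "j \<in> I0 q g x" for j
    proof (rule ccontr)
      assume n: "j \<notin> I0 q g xb"
      have j: "j \<in> {1..q}" and 0: "g j x = (\<lambda>_. 0)" using that by (auto simp: I0_def)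
      show False
      proof (cases "j \<in> IB q m g xb")
        case True
        from near_B[OF this] show False by (simp add: 0 hat_def)
      next
        case False
        from near_int[OF j n this] show False using enorm_nonneg[of "m j - 1" "hat (g j x)"] unfolding 0 by linarith
      qed
    qed
    have IB: "j \<in> IB q m g xb \<or> j \<in> I0 q g xb" if "j \<in> IB q m g x" for j
    proof (rule ccontr)
      assume n: "\<not> ?thesis"
      have j: "j \<in> {1..q}" and "g j x \<in> bd_plus (m j)" using that by (auto simp: IB_def)
      then have "g j x 0 = enorm (m j - 1) (hat (g j x))" using bd_plus_iff[OF m_ge_1] by blast
      with near_int[OF j] n show False by auto
    qed
    define e where "e j = (SOME v. unit_vec (m j - 1) v)" for j
    have e: "unit_vec (m j - 1) (e j)" if "j \<in> {1..q}" for j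
      unfolding e_def using m_ge_2[OF that] by (intro someI_ex[OF unit_vec_exists]) linarith
    \<comment> \<open>an index of \<open>I0 xb\<close> that is inactive at \<open>x\<close> has no vector in the families of
      \<open>x\<close>, so any unit vector will do for it\<close>
    define W where "W y v j = (if j \<in> I0 q g x then v j
      else if j \<in> IB q m g x then normalize_hat (m j) (g j y) else e j)" for y v j
    define \<phi> where "\<phi> = case_sum (\<lambda>j. if j \<in> IB q m g xb then Inl j else Inr (Inl j))
      (Inr :: nat + nat \<Rightarrow> nat + nat + nat)"
    define t where "t = case_sum (\<lambda>j. if j \<in> IB q m g xb then 1 else 2) (\<lambda>_ :: nat + nat. 1 :: real)"
    show "local_CQ K x"
    proof (rule local_CQ_I)
      fix S X w wb
      assume S: "S \<subseteq> IB q m g x <+> (I0 q g x <+> I0 q g x)" and X: "X \<longlonglongrightarrow> x"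
        and w: "\<And>j k. j \<in> I0 q g x \<Longrightarrow> unit_vec (m j - 1) (w k j)"
        and wb: "\<And>j. j \<in> I0 q g x \<Longrightarrow> unit_vec (m j - 1) (wb j)"
        and lim: "\<And>j i. j \<in> I0 q g x \<Longrightarrow> (\<lambda>k. w k j i) \<longlonglongrightarrow> wb j i"
        and dep: "dep_on K S (Dfam m g x wb)"
      have disj: "j \<notin> I0 q g x" if "j \<in> IB q m g x" for j using that I0_IB_disjoint by blast
      have D: "Dfam m g y (W y v) (\<phi> s) = t s *\<^sub>R Dfam m g y v s" if "s \<in> S" for y v s
      proof -
        consider j where "s = Inl j" "j \<in> IB q m g x" | j where "s = Inr (Inl j)" "j \<in> I0 q g x"
          | j where "s = Inr (Inr j)" "j \<in> I0 q g x"
          using subsetD[OF S \<open>s \<in> S\<close>] by auto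
        then show ?thesis
          by cases (auto simp: \<phi>_def t_def W_def Dfam_def jacT_mult_eigvec disj)
      qed
      have t: "t s > 0" for s by (auto simp: t_def split: sum.splits)
      have inj: "inj_on \<phi> S"
      proof (rule inj_onI)
        fix s s' assume "s \<in> S" "s' \<in> S" and eq: "\<phi> s = \<phi> s'"
        with subsetD[OF S] have "s \<in> IB q m g x <+> (I0 q g x <+> I0 q g x)"
          "s' \<in> IB q m g x <+> (I0 q g x <+> I0 q g x)" by blast+
        then show "s = s'" using eq disj by (auto simp: \<phi>_def split: if_splits)
      qed
      have \<phi>S: "\<phi> ` S \<subseteq> IB q m g xb <+> (I0 q g xb <+> I0 q g xb)"
      proof
        fix s' assume "s' \<in> \<phi> ` S"
        then obtain s where s: "s \<in> S" "s' = \<phi> s" by blast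
        consider j where "s = Inl j" "j \<in> IB q m g x" | j where "s = Inr (Inl j)" "j \<in> I0 q g x"
          | j where "s = Inr (Inr j)" "j \<in> I0 q g x"
          using s S by auto
        then show "s' \<in> IB q m g xb <+> (I0 q g xb <+> I0 q g xb)"
          using IB I0 by cases (auto simp: \<phi>_def s(2))
      qed
      have transfer: "dep_on L (\<phi> ` S) (Dfam m g y (W y v)) \<longleftrightarrow> dep_on L S (Dfam m g y v)"
        if "cone L" for L y v
        using that inj t D by (rule dep_on_reindex_scale)
      have dep': "dep_on K (\<phi> ` S) (Dfam m g x (W x wb))"
        using dep transfer[OF K(2)] by simp
      have W_unit: "unit_vec (m j - 1) (W y v j)"
        if "j \<in> {1..q}" "j \<in> I0 q g x \<Longrightarrow> unit_vec (m j - 1) (v j)"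
          "j \<in> IB q m g x \<Longrightarrow> hat (g j y) \<noteq> (\<lambda>_. 0)" for j y v
        using that e unit_vec_normalize_hat g_range by (auto simp: W_def)
      have W_unit_x: "unit_vec (m j - 1) (W x wb j)" if "j \<in> {1..q}" for j
        using W_unit[where v = wb and y = x, OF that] wb IB_hat_nonzero(1) by blast
      have W_lim: "(\<lambda>k. W (X k) (w k) j i) \<longlonglongrightarrow> W x wb j i" if "j \<in> {1..q}" for j i
      proof -
        have "(\<lambda>k. normalize_hat (m j) (g j (X k)) i) \<longlonglongrightarrow> normalize_hat (m j) (g j x) i"
          if B: "j \<in> IB q m g x"
          by (rule tendsto_normalize_hat[OF \<open>j \<in> {1..q}\<close> X IB_hat_nonzero(1)[OF B]])
        then show ?thesis using lim by (auto simp: W_def)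
      qed
      have "\<forall>\<^sub>F k in sequentially. \<forall>j\<in>I0 q g xb. unit_vec (m j - 1) (W (X k) (w k) j) \<and>
          (\<forall>i. \<bar>W x wb j i - W (X k) (w k) j i\<bar> < \<epsilon>)"
      proof (intro eventually_ball_finite finite_I0 ballI)
        fix j assume "j \<in> I0 q g xb"
        then have j: "j \<in> {1..q}" using I0_subset by blast
        have u: "\<forall>\<^sub>F k in sequentially. unit_vec (m j - 1) (W (X k) (w k) j)"
        proof (cases "j \<in> IB q m g x")
          case True
          from eventually_hat_nonzero[OF j X IB_hat_nonzero(1)[OF True]]
          show ?thesis
            by eventually_elim (use W_unit[where v = "w k" and y = "X k" for k, OF j] w in blast)
        next
          case False
          then show ?thesis
            using W_unit[where v = "w k" and y = "X k" for k, OF j] w by (auto intro: always_eventually)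
        qed
        from u unit_vec_eventually_close[OF W_lim[OF j] u W_unit_x[OF j] \<epsilon>]
        show "\<forall>\<^sub>F k in sequentially. unit_vec (m j - 1) (W (X k) (w k) j) \<and>
          (\<forall>i. \<bar>W x wb j i - W (X k) (w k) j i\<bar> < \<epsilon>)" by (rule eventually_conj)
      qed
      moreover have "\<forall>\<^sub>F k in sequentially. dist (X k) xb < \<epsilon>"
        using order_tendstoD(2)[OF tendsto_dist[OF X tendsto_const] x] .
      ultimately show "\<forall>\<^sub>F k in sequentially. lin_dep S (Dfam m g (X k) (w k))"
      proof eventually_elim
        case (elim k)
        have "lin_dep (\<phi> ` S) (Dfam m g (X k) (W (X k) (w k)))"
        proof (rule unif[OF \<phi>S x _ _ dep'])
          show "dist (X k) xb < \<epsilon>" using elim by blast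
          fix j assume "j \<in> I0 q g xb"
          then show "unit_vec (m j - 1) (W x wb j) \<and> unit_vec (m j - 1) (W (X k) (w k) j) \<and>
              (\<forall>i. \<bar>W x wb j i - W (X k) (w k) j i\<bar> < \<epsilon>)"
            using elim W_unit_x I0_subset by blast
        qed
        then show ?case
          unfolding lin_dep_eq_dep_on using transfer[of UNIV] by (simp add: cone_def)
      qed
    qed
  qed
qed

section \<open>Metric subregularity\<close>

text \<open>The quantitative content of the qualification: were the coefficients of independent
  subfamilies unbounded, then normalising them would produce a positive dependence at \<open>xb\<close>, and
  hence linear dependence nearby.\<close>

lemma local_CQ_coefficient_bound:
  assumes cq: "local_CQ {0..} xb"
  shows "\<exists>\<epsilon>>0. \<forall>S\<in>Pow (IB q m g xb <+> (I0 q g xb <+> I0 q g xb)). \<forall>x w c.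
    dist x xb < \<epsilon> \<longrightarrow> (\<forall>j\<in>I0 q g xb. unit_vec (m j - 1) (w j)) \<longrightarrow>
    \<not> lin_dep S (Dfam m g x w) \<longrightarrow> (\<forall>s\<in>S. c s \<ge> 0) \<longrightarrow>
    \<epsilon> * (\<Sum>s\<in>S. c s) \<le> norm (\<Sum>s\<in>S. c s *\<^sub>R Dfam m g x w s)"
    (is "\<exists>\<epsilon>>0. \<forall>S\<in>Pow ?U. ?P \<epsilon> S")
proof (rule finite_uniform_radius)
  show "finite (Pow ?U)" using finite_IB finite_I0 by simp
  show "?P e' S" if "0 < e'" "e' \<le> e" "?P e S" for e e' S
  proof (intro allI impI)
    fix x w c
    assume *: "dist x xb < e'" "\<forall>j\<in>I0 q g xb. unit_vec (m j - 1) (w j)"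
      "\<not> lin_dep S (Dfam m g x w)" "\<forall>s\<in>S. c s \<ge> (0::real)"
    have "e * (\<Sum>s\<in>S. c s) \<le> norm (\<Sum>s\<in>S. c s *\<^sub>R Dfam m g x w s)"
      using that * by (meson order_less_le_trans)
    moreover have "e' * (\<Sum>s\<in>S. c s) \<le> e * (\<Sum>s\<in>S. c s)"
      using that *(4) by (intro mult_right_mono sum_nonneg) auto
    ultimately show "e' * (\<Sum>s\<in>S. c s) \<le> norm (\<Sum>s\<in>S. c s *\<^sub>R Dfam m g x w s)" by simp
  qed
  fix S assume "S \<in> Pow ?U"
  then have S: "S \<subseteq> ?U" by simp
  have fS: "finite S" using S finite_IB finite_I0 by (auto intro: finite_subset)
  show "\<exists>e>0. ?P e S"
  proof (rule ccontr)
    assume neg: "\<not> (\<exists>e>0. ?P e S)"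
    have "\<exists>x w c. dist x xb < 1 / Suc k \<and> (\<forall>j\<in>I0 q g xb. unit_vec (m j - 1) (w j)) \<and>
      \<not> lin_dep S (Dfam m g x w) \<and> (\<forall>s\<in>S. c s \<ge> 0) \<and>
      norm (\<Sum>s\<in>S. c s *\<^sub>R Dfam m g x w s) < 1 / Suc k * (\<Sum>s\<in>S. c s)" for k
    proof -
      have "\<not> ?P (1 / Suc k) S"
      proof
        assume P: "?P (1 / Suc k) S"
        have "\<exists>e>0. ?P e S" by (rule exI[of _ "1 / Suc k"], rule conjI[OF _ P]) simp
        with neg show False by contradiction
      qed
      then show ?thesis by (simp only: not_all not_imp not_le)
    qed
    then have "\<forall>k. \<exists>x w c. dist x xb < 1 / Suc k \<and>
      (\<forall>j\<in>I0 q g xb. unit_vec (m j - 1) (w j)) \<and>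
      \<not> lin_dep S (Dfam m g x w) \<and> (\<forall>s\<in>S. c s \<ge> 0) \<and>
      norm (\<Sum>s\<in>S. c s *\<^sub>R Dfam m g x w s) < 1 / Suc k * (\<Sum>s\<in>S. c s)" by (rule allI)
    then obtain x w c where *: "\<forall>k. dist (x k) xb < 1 / Suc k \<and>
      (\<forall>j\<in>I0 q g xb. unit_vec (m j - 1) (w k j)) \<and>
      \<not> lin_dep S (Dfam m g (x k) (w k)) \<and> (\<forall>s\<in>S. c k s \<ge> 0) \<and>
      norm (\<Sum>s\<in>S. c k s *\<^sub>R Dfam m g (x k) (w k) s) < 1 / Suc k * (\<Sum>s\<in>S. c k s)"
      unfolding choice_iff by (elim exE) (rule that)
    then have x: "\<And>k. dist (x k) xb < 1 / Suc k"
      and w: "\<And>k. \<forall>j\<in>I0 q g xb. unit_vec (m j - 1) (w k j)"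
      and indep: "\<And>k. \<not> lin_dep S (Dfam m g (x k) (w k))"
      and c: "\<And>k. \<forall>s\<in>S. c k s \<ge> 0"
      and small: "\<And>k. norm (\<Sum>s\<in>S. c k s *\<^sub>R Dfam m g (x k) (w k) s) < 1 / Suc k * (\<Sum>s\<in>S. c k s)"
      by blast+
    have inv: "(\<lambda>k. 1 / real (Suc k)) \<longlonglongrightarrow> 0"
      using LIMSEQ_inverse_real_of_nat by (simp add: inverse_eq_divide)
    have "x \<longlonglongrightarrow> xb"
      by (rule metric_tendsto_imp_tendsto[OF inv]) (use x in \<open>auto intro!: always_eventually less_imp_le\<close>)
    obtain r wb where r: "strict_mono (r :: nat \<Rightarrow> nat)"
      and wb: "\<And>j. j \<in> I0 q g xb \<Longrightarrow> unit_vec (m j - 1) (wb j)"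
      and lim: "\<And>j i. j \<in> I0 q g xb \<Longrightarrow> (\<lambda>k. w (r k) j i) \<longlonglongrightarrow> wb j i"
      using unit_family_subseq[of "I0 q g xb" "\<lambda>j. m j - 1" w, OF finite_I0] w by blast
    have xr: "(\<lambda>k. x (r k)) \<longlonglongrightarrow> xb"
      using LIMSEQ_subseq_LIMSEQ[OF \<open>x \<longlonglongrightarrow> xb\<close> r] by (simp add: o_def)
    define N where "N k = (\<Sum>s\<in>S. c k s)" for k
    have N: "N k > 0" for k
    proof -
      have "0 < 1 / Suc k * N k" using small[of k] norm_ge_zero order_le_less_trans unfolding N_def by blast
      then show ?thesis by (simp add: zero_less_divide_iff)
    qed
    have "dep_on {0..} S (Dfam m g xb wb)"
    proof (rule dep_on_limit[OF fS, where c = "\<lambda>k s. c (r k) s / N (r k)"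
          and v = "\<lambda>k. Dfam m g (x (r k)) (w (r k))"])
      show "c (r k) s / N (r k) \<in> {0..}" if "s \<in> S" for k s
        using c N[of "r k"] that by simp
      show "(\<Sum>s\<in>S. \<bar>c (r k) s / N (r k)\<bar>) = 1" for k
      proof -
        have "(\<Sum>s\<in>S. \<bar>c (r k) s / N (r k)\<bar>) = (\<Sum>s\<in>S. c (r k) s / N (r k))"
          using c N[of "r k"] by (intro sum.cong) auto
        also have "\<dots> = N (r k) / N (r k)" by (simp add: N_def flip: sum_divide_distrib)
        finally show ?thesis using N[of "r k"] by simp
      qed
      show "(\<lambda>k. \<Sum>s\<in>S. (c (r k) s / N (r k)) *\<^sub>R Dfam m g (x (r k)) (w (r k)) s) \<longlonglongrightarrow> 0"
      proof (rule Lim_null_comparison[OF always_eventually], rule allI)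
        fix k
        have "(\<Sum>s\<in>S. (c (r k) s / N (r k)) *\<^sub>R Dfam m g (x (r k)) (w (r k)) s) =
            (1 / N (r k)) *\<^sub>R (\<Sum>s\<in>S. c (r k) s *\<^sub>R Dfam m g (x (r k)) (w (r k)) s)"
          by (simp add: scaleR_sum_right)
        then show "norm (\<Sum>s\<in>S. (c (r k) s / N (r k)) *\<^sub>R Dfam m g (x (r k)) (w (r k)) s)
            \<le> 1 / Suc (r k)"
          using small[of "r k"] N[of "r k"] by (simp add: N_def pos_divide_le_eq)
        show "(\<lambda>k. 1 / real (Suc (r k))) \<longlonglongrightarrow> 0"
          using LIMSEQ_subseq_LIMSEQ[OF inv r] by (simp add: o_def)
      qed
      show "(\<lambda>k. Dfam m g (x (r k)) (w (r k)) s) \<longlonglongrightarrow> Dfam m g xb wb s" if "s \<in> S" for s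
        by (rule tendsto_Dfam_active[OF subsetD[OF S that] xr lim])
    qed simp
    then have "\<forall>\<^sub>F k in sequentially. lin_dep S (Dfam m g (x (r k)) (w (r k)))"
      using w wb lim by (intro local_CQ_D[OF cq S xr]) auto
    then show False using indep by (simp add: eventually_False)
  qed
qed

lemma inner_jacT_mult:
  assumes j: "j \<in> {1..q}"
  shows "jacT_mult (m j) (g j) x v \<bullet> d
    = (\<Sum>i<m j. v i * frechet_derivative (\<lambda>z. g j z i) (at x) d)"
proof -
  have fd: "frechet_derivative (\<lambda>z. g j z i) (at x) d
      = (\<Sum>l\<in>UNIV. d $ l * frechet_derivative (\<lambda>z. g j z i) (at x) (axis l 1))" if "i < m j" for i
  proof -
    have lin: "linear (frechet_derivative (\<lambda>z. g j z i) (at x))"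
      using C1_has_derivative[OF g_C1[OF j that]] by (rule has_derivative_linear)
    have "frechet_derivative (\<lambda>z. g j z i) (at x) d
        = frechet_derivative (\<lambda>z. g j z i) (at x) (\<Sum>l\<in>UNIV. d $ l *\<^sub>R axis l 1)"
      using basis_expansion[of d] by (simp add: scalar_mult_eq_scaleR)
    then show ?thesis using lin by (simp add: linear_sum linear_cmul)
  qed
  have "jacT_mult (m j) (g j) x v \<bullet> d = (\<Sum>l\<in>UNIV. \<Sum>i<m j. jac (g j) x i l * v i * d $ l)"
    by (simp add: inner_vec_def jacT_mult_def sum_distrib_right)
  also have "\<dots> = (\<Sum>i<m j. v i * (\<Sum>l\<in>UNIV. d $ l * jac (g j) x i l))"
    by (subst sum.swap) (simp add: sum_distrib_left algebra_simps)
  finally show ?thesis by (simp add: fd jac_def)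
qed

definition total_gap :: "real ^ 'n \<Rightarrow> real"
  where "total_gap x = (\<Sum>j\<in>{1..q}. soc_gap (m j) (g j x))"

lemma total_gap_nonneg: "total_gap x \<ge> 0"
  unfolding total_gap_def by (intro sum_nonneg soc_gap_nonneg)

lemma total_gap_eq_0_iff: "total_gap x = 0 \<longleftrightarrow> x \<in> feasible q m g"
  unfolding total_gap_def feasible_def
  by (subst sum_nonneg_eq_0_iff) (auto simp: soc_gap_nonneg soc_gap_eq_0_iff[OF g_range])

lemma tendsto_total_gap: "(X \<longlongrightarrow> x) F \<Longrightarrow> ((\<lambda>k. total_gap (X k)) \<longlongrightarrow> total_gap x) F"
  unfolding total_gap_def by (intro tendsto_sum tendsto_soc_gap tendsto_g)

text \<open>Stationarity for the quadratic penalty. Replacing the distance to the cones by the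
  distance to the projections \<open>p\<^sub>j\<close> of \<open>g\<^sub>j(z)\<close> gives a differentiable majorant that agrees
  with the penalty at \<open>z\<close>; so \<open>z\<close> also minimises the majorant, and its derivative
  vanishes there.\<close>

lemma penalty_stationary:
  assumes r: "z \<in> ball xb r" and \<rho>: "\<rho> \<ge> 0"
    and min: "\<And>y. y \<in> ball xb r \<Longrightarrow>
      (norm (z - x))\<^sup>2 + \<rho> * total_gap z \<le> (norm (y - x))\<^sup>2 + \<rho> * total_gap y"
    and w: "\<And>j. j \<in> {1..q} \<Longrightarrow> eig_dir (m j) (g j z) (w j)"
  shows "z - x = (\<Sum>j\<in>{1..q}. \<rho> *\<^sub>R
    (max 0 (enorm (m j - 1) (hat (g j z)) - g j z 0) *\<^sub>R jacT_mult (m j) (g j) z (eigvec1 (w j)) +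
     max 0 (- enorm (m j - 1) (hat (g j z)) - g j z 0) *\<^sub>R jacT_mult (m j) (g j) z (eigvec2 (w j))))"
proof -
  define a where "a j = max 0 (enorm (m j - 1) (hat (g j z)) - g j z 0)" for j
  define b where "b j = max 0 (- enorm (m j - 1) (hat (g j z)) - g j z 0)" for j
  define p where "p j i = g j z i + a j * eigvec1 (w j) i + b j * eigvec2 (w j) i" for j i
  have p: "p j \<in> soc (m j)" and p_gap: "(\<Sum>i<m j. (g j z i - p j i)\<^sup>2) = soc_gap (m j) (g j z)"
    if "j \<in> {1..q}" for j
    using soc_projection(1,2)[OF m_ge_2 g_range w, OF that that that]
    by (simp_all add: a_def b_def p_def[abs_def])
  have gap_le: "soc_gap (m j) (g j y) \<le> (\<Sum>i<m j. (g j y i - p j i)\<^sup>2)" if j: "j \<in> {1..q}" for j y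
  proof -
    obtain v where "eig_dir (m j) (g j y) v" using eig_dir_exists[OF m_ge_2[OF j]] by blast
    from soc_projection(3)[OF m_ge_2[OF j] g_range[OF j] this p[OF j]] show ?thesis .
  qed
  define F where "F y = (norm (y - x))\<^sup>2 + \<rho> * (\<Sum>j\<in>{1..q}. \<Sum>i<m j. (g j y i - p j i)\<^sup>2)" for y
  define v where "v = (z - x) + (\<Sum>j\<in>{1..q}. \<rho> *\<^sub>R jacT_mult (m j) (g j) z (\<lambda>i. g j z i - p j i))"
  have F_min: "F z \<le> F y" if "y \<in> ball xb r" for y
  proof -
    have "F z = (norm (z - x))\<^sup>2 + \<rho> * total_gap z"
      by (simp add: F_def total_gap_def p_gap)
    also have "\<dots> \<le> (norm (y - x))\<^sup>2 + \<rho> * total_gap y" by (rule min[OF that])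
    also have "\<dots> \<le> F y"
      unfolding F_def total_gap_def using \<rho> gap_le
      by (intro add_left_mono mult_left_mono sum_mono) auto
    finally show ?thesis .
  qed
  have "(F has_derivative (\<lambda>d. 2 * ((z - x) \<bullet> d) + \<rho> * (\<Sum>j\<in>{1..q}. \<Sum>i<m j.
      2 * ((g j z i - p j i) * frechet_derivative (\<lambda>y. g j y i) (at z) d)))) (at z)"
    unfolding F_def power2_norm_eq_inner
    by (rule derivative_eq_intros C1_has_derivative[OF g_C1] refl | simp)+
      (auto simp: inner_commute algebra_simps)
  then have "(\<lambda>d. 2 * ((z - x) \<bullet> d) + \<rho> * (\<Sum>j\<in>{1..q}. \<Sum>i<m j.
      2 * ((g j z i - p j i) * frechet_derivative (\<lambda>y. g j y i) (at z) d))) = (\<lambda>d. 0)"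
    by (rule has_derivative_local_min) (use r F_min in \<open>auto simp: eventually_at_topological intro!: exI[of _ "ball xb r"]\<close>)
  from fun_cong[OF this, of v]
  have "2 * (v \<bullet> v) = 0"
    by (subst (1) v_def) (simp add: inner_add_left inner_sum_left inner_jacT_mult sum_distrib_left algebra_simps)
  then have v0: "v = 0" by simp
  have "jacT_mult (m j) (g j) z (\<lambda>i. g j z i - p j i) =
      - (a j *\<^sub>R jacT_mult (m j) (g j) z (eigvec1 (w j)) + b j *\<^sub>R jacT_mult (m j) (g j) z (eigvec2 (w j)))" for j
  proof -
    have "(\<lambda>i. g j z i - p j i) = (\<lambda>i. - a j * eigvec1 (w j) i + - b j * eigvec2 (w j) i)"
      by (simp add: p_def)
    then show ?thesis by (simp only: jacT_mult_add jacT_mult_scale) simp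
  qed
  then have "v = (z - x) - (\<Sum>j\<in>{1..q}. \<rho> *\<^sub>R
      (a j *\<^sub>R jacT_mult (m j) (g j) z (eigvec1 (w j)) + b j *\<^sub>R jacT_mult (m j) (g j) z (eigvec2 (w j))))"
    unfolding v_def
    by (simp only: scaleR_minus_right sum_negf add_uminus_conv_diff)
  with v0 show ?thesis by (simp add: a_def b_def)
qed

lemma strictly_differentiable_near:
  assumes \<delta>: "\<delta> > 0"
  shows "\<exists>r>0. \<forall>p\<in>(SIGMA j:{1..q}. {..<m j}). \<forall>x\<in>ball xb r. \<forall>z\<in>ball xb r.
    \<bar>g (fst p) z (snd p) - g (fst p) x (snd p)
      - frechet_derivative (\<lambda>y. g (fst p) y (snd p)) (at z) (z - x)\<bar> \<le> \<delta> * norm (z - x)"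
proof (rule finite_uniform_radius)
  show "\<exists>e>0. \<forall>x\<in>ball xb e. \<forall>z\<in>ball xb e. \<bar>g (fst p) z (snd p) - g (fst p) x (snd p)
      - frechet_derivative (\<lambda>y. g (fst p) y (snd p)) (at z) (z - x)\<bar> \<le> \<delta> * norm (z - x)"
    if "p \<in> (SIGMA j:{1..q}. {..<m j})" for p
    using that by (intro C1_strictly_differentiable[OF g_C1 \<delta>]) auto
qed (auto dest: subsetD[OF subset_ball])

text \<open>In the application \<open>v\<close> is a multiple of an eigenvector with negative eigenvalue at
  \<open>g\<^sub>j(z)\<close> and \<open>p\<close> is a point of the cone. Then
  \<open>v \<bullet> g\<^sub>j(z) \<le> 0 \<le> v \<bullet> p\<close>, so the left-hand side, which is
  \<open>v \<bullet> (g\<^sub>j(z) - g\<^sub>j(x))\<close> to first order, is at most \<open>v \<bullet> (p - g\<^sub>j(x))\<close>.\<close>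

lemma inner_jacT_mult_le:
  assumes j: "j \<in> {1..q}"
    and lin: "\<And>i. i < m j \<Longrightarrow> \<bar>g j z i - g j x i - frechet_derivative (\<lambda>y. g j y i) (at z) (z - x)\<bar>
      \<le> \<delta> * norm (z - x)"
    and v1: "\<And>i. \<bar>v i\<bar> \<le> 1" and vz: "(\<Sum>i<m j. v i * g j z i) \<le> 0"
    and vp: "(\<Sum>i<m j. v i * p i) \<ge> 0"
  shows "jacT_mult (m j) (g j) z v \<bullet> (z - x)
    \<le> real (m j) * (enorm (m j) (\<lambda>i. g j x i - p i) + \<delta> * norm (z - x))"
proof -
  have "jacT_mult (m j) (g j) z v \<bullet> (z - x)
      = (\<Sum>i<m j. v i * frechet_derivative (\<lambda>y. g j y i) (at z) (z - x))"
    by (rule inner_jacT_mult[OF j])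
  also have "\<dots> \<le> (\<Sum>i<m j. v i * g j z i - v i * p i
      + (enorm (m j) (\<lambda>i. g j x i - p i) + \<delta> * norm (z - x)))"
  proof (rule sum_mono)
    fix i assume "i \<in> {..<m j}"
    then have i: "i < m j" by simp
    let ?e = "g j z i - g j x i - frechet_derivative (\<lambda>y. g j y i) (at z) (z - x)"
    have *: "- (v i * c) \<le> C" if "\<bar>c\<bar> \<le> C" for c C
    proof -
      have "\<bar>v i * c\<bar> \<le> 1 * \<bar>c\<bar>" unfolding abs_mult by (intro mult_right_mono v1) auto
      with that show ?thesis by linarith
    qed
    have "v i * frechet_derivative (\<lambda>y. g j y i) (at z) (z - x)
        = v i * g j z i - v i * p i - v i * (g j x i - p i) - v i * ?e"
      by (simp add: algebra_simps)
    then show "v i * frechet_derivative (\<lambda>y. g j y i) (at z) (z - x)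
        \<le> v i * g j z i - v i * p i + (enorm (m j) (\<lambda>i. g j x i - p i) + \<delta> * norm (z - x))"
      using *[OF lin[OF i]] *[OF abs_le_enorm[OF i, of "\<lambda>i. g j x i - p i"]] by linarith
  qed
  also have "\<dots> = (\<Sum>i<m j. v i * g j z i) - (\<Sum>i<m j. v i * p i)
      + real (m j) * (enorm (m j) (\<lambda>i. g j x i - p i) + \<delta> * norm (z - x))"
    by (simp add: sum.distrib sum_subtractf)
  finally show ?thesis using vz vp by linarith
qed

text \<open>For \<open>x\<close> near \<open>xb\<close> the function \<open>\<parallel>z - x\<parallel>\<^sup>2 + \<rho> * total_gap z\<close> is minimised over
  a ball around \<open>xb\<close>. Since \<open>xb\<close> is feasible, a minimiser is no farther from \<open>x\<close> than
  \<open>xb\<close> is, and so it lies inside the ball and is stationary. Stationarity writes \<open>z - x\<close> as a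
  conic combination of family vectors that belong to negative eigenvalues of \<open>g\<^sub>j(z)\<close>, and the
  coefficient bound turns this into \<open>\<parallel>z - x\<parallel> \<le> \<gamma> dist(g(x), L)\<close>, \<open>L\<close> the product of the cones, with \<open>\<gamma>\<close>
  independent of \<open>\<rho>\<close>.\<close>

lemma local_CQ_imp_MSCQ:
  assumes xb: "xb \<in> feasible q m g" and cq: "local_CQ {0..} xb"
  shows "MSCQ q m g xb"
proof -
  let ?U = "IB q m g xb <+> (I0 q g xb <+> I0 q g xb)"
  from local_CQ_coefficient_bound[OF cq] obtain \<epsilon> where \<epsilon>: "\<epsilon> > 0"
    and bd: "\<forall>S\<in>Pow ?U. \<forall>x w c.
      dist x xb < \<epsilon> \<longrightarrow> (\<forall>j\<in>I0 q g xb. unit_vec (m j - 1) (w j)) \<longrightarrow>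
      \<not> lin_dep S (Dfam m g x w) \<longrightarrow> (\<forall>s\<in>S. c s \<ge> 0) \<longrightarrow>
      \<epsilon> * (\<Sum>s\<in>S. c s) \<le> norm (\<Sum>s\<in>S. c s *\<^sub>R Dfam m g x w s)"
    by (elim exE conjE) (rule that)
  define N where "N = real (\<Sum>j\<in>{1..q}. m j)"
  have N0: "N \<ge> 0" unfolding N_def by (rule of_nat_0_le_iff)
  have mN: "real (m j) \<le> N" if "j \<in> {1..q}" for j
    unfolding N_def of_nat_le_iff using that by (intro member_le_sum) auto
  \<comment> \<open>so small that the linearisation error uses up at most half of the displacement\<close>
  define \<delta> where "\<delta> = \<epsilon> / (2 * N + 1)"
  have \<delta>: "\<delta> > 0" "2 * N * \<delta> \<le> \<epsilon>"
    using \<epsilon> N0 by (auto simp: \<delta>_def field_simps add_nonneg_pos)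
  obtain r1 where r1: "r1 > 0" and lin: "\<And>j i x z. j \<in> {1..q} \<Longrightarrow> i < m j \<Longrightarrow>
      x \<in> ball xb r1 \<Longrightarrow> z \<in> ball xb r1 \<Longrightarrow>
      \<bar>g j z i - g j x i - frechet_derivative (\<lambda>y. g j y i) (at z) (z - x)\<bar> \<le> \<delta> * norm (z - x)"
    using strictly_differentiable_near[OF \<delta>(1), of xb] by fastforce
  obtain r2 where r2: "r2 > 0"
    and near: "\<And>x. dist x xb < r2 \<Longrightarrow>
      (\<forall>j\<in>IB q m g xb. hat (g j x) \<noteq> (\<lambda>_. 0) \<and> g j x 0 + enorm (m j - 1) (hat (g j x)) > 0) \<and>
      (\<forall>j\<in>{1..q} - (I0 q g xb \<union> IB q m g xb). enorm (m j - 1) (hat (g j x)) < g j x 0)"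
    using active_sets_near[OF xb] unfolding eventually_nhds_metric by blast
  define r where "r = min \<epsilon> (min r1 r2)"
  have r: "r > 0" "r \<le> \<epsilon>" "r \<le> r1" "r \<le> r2" using \<epsilon> r1 r2 by (auto simp: r_def)
  \<comment> \<open>the error bound for the penalty minimisers, uniformly in the penalty parameter\<close>
  have step: "\<epsilon> * norm (z - x) \<le> 2 * N * L2_set (\<lambda>j. enorm (m j) (\<lambda>i. g j x i - p j i)) {1..q}"
    if x: "x \<in> ball xb r" and z: "z \<in> ball xb r" and \<rho>: "\<rho> \<ge> 0"
      and min: "\<And>y. y \<in> ball xb r \<Longrightarrow>
        (norm (z - x))\<^sup>2 + \<rho> * total_gap z \<le> (norm (y - x))\<^sup>2 + \<rho> * total_gap y"
      and p: "\<And>j. j \<in> {1..q} \<Longrightarrow> p j \<in> soc (m j)"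
    for x z \<rho> p
  proof -
    let ?n = "\<lambda>j. enorm (m j - 1) (hat (g j z))"
    let ?L = "L2_set (\<lambda>j. enorm (m j) (\<lambda>i. g j x i - p j i)) {1..q}"
    define w where "w j = (SOME w. eig_dir (m j) (g j z) w)" for j
    have w: "eig_dir (m j) (g j z) (w j)" if "j \<in> {1..q}" for j
      unfolding w_def using that by (intro someI_ex[OF eig_dir_exists] m_ge_2)
    have uw: "unit_vec (m j - 1) (w j)" if "j \<in> {1..q}" for j
      by (rule eig_dir_unit_vec[OF g_range[OF that] w[OF that]])
    define a where "a j = max 0 (?n j - g j z 0)" for j
    define b where "b j = max 0 (- ?n j - g j z 0)" for j
    have ab: "a j \<ge> 0" "b j \<ge> 0" for j by (auto simp: a_def b_def)
    define c where "c = case_sum (\<lambda>j. \<rho> * a j) (case_sum (\<lambda>j. \<rho> * a j / 2) (\<lambda>j. \<rho> * b j / 2))"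
    have c0: "c s \<ge> 0" for s using \<rho> ab by (auto simp: c_def split: sum.split)
    have z': "dist z xb < r2" "dist z xb < \<epsilon>" using z r by (auto simp: dist_commute)
    define h where "h j = \<rho> *\<^sub>R (a j *\<^sub>R jacT_mult (m j) (g j) z (eigvec1 (w j)) +
        b j *\<^sub>R jacT_mult (m j) (g j) z (eigvec2 (w j)))" for j
    \<comment> \<open>near \<open>xb\<close> the larger eigenvalue of a boundary index stays positive, so only the first eigenvector
      contributes; at inactive indices there is no contribution\<close>
    have hB: "h j = c (Inl j) *\<^sub>R Dfam m g z w (Inl j)" if "j \<in> IB q m g xb" for j
    proof -
      have B: "hat (g j z) \<noteq> (\<lambda>_. 0)" "g j z 0 + ?n j > 0" using near[OF z'(1)] that by auto
      have "j \<in> {1..q}" using that IB_subset by blast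
      then have "w j = normalize_hat (m j) (g j z)" using w[of j] B(1) by (simp add: eig_dir_def)
      moreover have "b j = 0" using B(2) by (simp add: b_def)
      ultimately show ?thesis by (simp add: h_def c_def Dfam_def)
    qed
    have h0: "h j = c (Inr (Inl j)) *\<^sub>R Dfam m g z w (Inr (Inl j))
        + c (Inr (Inr j)) *\<^sub>R Dfam m g z w (Inr (Inr j))" for j
      by (simp add: h_def c_def Dfam_def jacT_mult_eigvec algebra_simps)
    have hI: "h j = 0" if "j \<in> {1..q} - (I0 q g xb \<union> IB q m g xb)" for j
    proof -
      have "?n j < g j z 0" using near[OF z'(1)] that by blast
      then have "a j = 0" "b j = 0" using enorm_nonneg[of "m j - 1" "hat (g j z)"]
        unfolding a_def b_def by linarith+
      then show ?thesis by (simp add: h_def)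
    qed
    have "z - x = (\<Sum>j\<in>{1..q}. h j)"
      using penalty_stationary[OF z \<rho> min w] by (simp add: h_def a_def b_def)
    also have "\<dots> = (\<Sum>j\<in>I0 q g xb \<union> IB q m g xb. h j)"
      using hI I0_subset IB_subset by (intro sum.mono_neutral_right) auto
    also have "\<dots> = (\<Sum>j\<in>IB q m g xb. h j) + (\<Sum>j\<in>I0 q g xb. h j)"
      using I0_IB_disjoint finite_I0 finite_IB by (simp add: sum.union_disjoint add.commute)
    also have "\<dots> = (\<Sum>s\<in>?U. c s *\<^sub>R Dfam m g z w s)"
      using hB by (simp add: sum.Plus finite_I0 finite_IB h0 sum.distrib)
    also have "\<dots> = (\<Sum>s\<in>{s\<in>?U. c s > 0}. c s *\<^sub>R Dfam m g z w s)"
    proof (rule sum.mono_neutral_right)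
      show "\<forall>s\<in>?U - {s\<in>?U. c s > 0}. c s *\<^sub>R Dfam m g z w s = 0"
      proof
        fix s assume "s \<in> ?U - {s\<in>?U. c s > 0}"
        then have "c s = 0" using c0[of s] by auto
        then show "c s *\<^sub>R Dfam m g z w s = 0" by simp
      qed
    qed (auto simp: finite_I0 finite_IB)
    finally have zx: "z - x = (\<Sum>s\<in>{s\<in>?U. c s > 0}. c s *\<^sub>R Dfam m g z w s)" .
    show ?thesis
    proof (rule displacement_bound[OF \<epsilon> _ _ zx])
      show "finite {s\<in>?U. c s > 0}" by (simp add: finite_I0 finite_IB)
      show "\<epsilon> * (\<Sum>s\<in>T. d s) \<le> norm (\<Sum>s\<in>T. d s *\<^sub>R Dfam m g z w s)"
        if "T \<subseteq> {s\<in>?U. c s > 0}" "\<not> lin_dep T (Dfam m g z w)" "\<And>s. s \<in> T \<Longrightarrow> d s \<ge> 0" for T d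
      proof -
        have "T \<in> Pow ?U" using that(1) by blast
        moreover have "\<forall>j\<in>I0 q g xb. unit_vec (m j - 1) (w j)" using uw I0_subset by blast
        ultimately show ?thesis using bd z'(2) that(2,3) by blast
      qed
      show "c s \<ge> 0" for s by (rule c0)
      show "Dfam m g z w s \<bullet> (z - x) \<le> N * (?L + \<delta> * norm (z - x))"
        if s: "s \<in> {s\<in>?U. c s > 0}" for s
      proof -
        have single: "jacT_mult (m j) (g j) z v \<bullet> (z - x) \<le> N * (?L + \<delta> * norm (z - x))"
          if j: "j \<in> {1..q}" and v: "\<And>i. \<bar>v i\<bar> \<le> 1" "(\<Sum>i<m j. v i * g j z i) \<le> 0"
            "(\<Sum>i<m j. v i * p j i) \<ge> 0" for j v
        proof -
          let ?e = "enorm (m j) (\<lambda>i. g j x i - p j i)"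
          have "jacT_mult (m j) (g j) z v \<bullet> (z - x) \<le> real (m j) * (?e + \<delta> * norm (z - x))"
            using x z r(3) by (intro inner_jacT_mult_le[OF j lin[OF j] v]) auto
          also have "\<dots> \<le> N * (?L + \<delta> * norm (z - x))"
            using mN[OF j] N0 \<delta>(1) member_le_L2_set[of "{1..q}" j "\<lambda>j. enorm (m j) (\<lambda>i. g j x i - p j i)"] j
            by (intro mult_mono add_right_mono add_nonneg_nonneg) auto
          finally show ?thesis .
        qed
        have w1: "\<bar>w j i\<bar> \<le> 1" if "j \<in> {1..q}" for j i by (rule unit_vec_abs_le_1[OF uw[OF that]])
        have e1: "\<bar>eigvec1 (w j) i\<bar> \<le> 1/2" "\<bar>eigvec2 (w j) i\<bar> \<le> 1/2" if "j \<in> {1..q}" for j i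
          using w1[OF that] by (auto simp: eigvec1_def eigvec2_def split: nat.split)
        have dbl: "case_nat 1 (\<lambda>l. - u l) = (\<lambda>i. 2 * eigvec1 u i)" "case_nat 1 u = (\<lambda>i. 2 * eigvec2 u i)" for u
          by (auto simp: eigvec1_def eigvec2_def fun_eq_iff split: nat.split)
        note ip = inner_eigvec_eig_dir[OF m_ge_1 g_range w] and ipp = inner_eigvec_soc_nonneg[OF m_ge_1 uw p]
        \<comment> \<open>\<open>t = 1\<close> for the vectors of boundary indices, \<open>t = 2\<close> for those of indices in \<open>I0\<close>\<close>
        have bound1: "jacT_mult (m j) (g j) z (\<lambda>i. t * eigvec1 (w j) i) \<bullet> (z - x) \<le> N * (?L + \<delta> * norm (z - x))"
          if j: "j \<in> {1..q}" and a: "a j > 0" and t: "t \<ge> 0" "t \<le> 2" for j t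
        proof (rule single[OF j])
          have "\<bar>t * eigvec1 (w j) i\<bar> \<le> 2 * (1/2)" for i
            unfolding abs_mult using e1(1)[OF j] t by (intro mult_mono) auto
          then show "\<bar>t * eigvec1 (w j) i\<bar> \<le> 1" for i by simp
          have "(\<Sum>i<m j. eigvec1 (w j) i * g j z i) \<le> 0"
            using ip(1)[OF j j j] a by (simp add: a_def max_def split: if_splits)
          then show "(\<Sum>i<m j. t * eigvec1 (w j) i * g j z i) \<le> 0"
            using t(1) by (simp add: mult.assoc mult_nonneg_nonpos flip: sum_distrib_left)
          show "(\<Sum>i<m j. t * eigvec1 (w j) i * p j i) \<ge> 0"
            using t(1) ipp(1)[OF j j j] by (simp add: mult.assoc flip: sum_distrib_left)
        qed
        have bound2: "jacT_mult (m j) (g j) z (\<lambda>i. t * eigvec2 (w j) i) \<bullet> (z - x) \<le> N * (?L + \<delta> * norm (z - x))"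
          if j: "j \<in> {1..q}" and b: "b j > 0" and t: "t \<ge> 0" "t \<le> 2" for j t
        proof (rule single[OF j])
          have "\<bar>t * eigvec2 (w j) i\<bar> \<le> 2 * (1/2)" for i
            unfolding abs_mult using e1(2)[OF j] t by (intro mult_mono) auto
          then show "\<bar>t * eigvec2 (w j) i\<bar> \<le> 1" for i by simp
          have "(\<Sum>i<m j. eigvec2 (w j) i * g j z i) \<le> 0"
            using ip(2)[OF j j j] b by (simp add: b_def max_def split: if_splits)
          then show "(\<Sum>i<m j. t * eigvec2 (w j) i * g j z i) \<le> 0"
            using t(1) by (simp add: mult.assoc mult_nonneg_nonpos flip: sum_distrib_left)
          show "(\<Sum>i<m j. t * eigvec2 (w j) i * p j i) \<ge> 0"
            using t(1) ipp(2)[OF j j j] by (simp add: mult.assoc flip: sum_distrib_left)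
        qed
        have pos: "a j > 0" if "c (Inl j) > 0 \<or> c (Inr (Inl j)) > 0" for j
          using that ab[of j] \<rho> by (auto simp: c_def zero_less_mult_iff)
        have pos2: "b j > 0" if "c (Inr (Inr j)) > 0" for j
          using that ab[of j] \<rho> by (auto simp: c_def zero_less_mult_iff)
        consider j where "s = Inl j" "j \<in> IB q m g xb" "c (Inl j) > 0"
          | j where "s = Inr (Inl j)" "j \<in> I0 q g xb" "c (Inr (Inl j)) > 0"
          | j where "s = Inr (Inr j)" "j \<in> I0 q g xb" "c (Inr (Inr j)) > 0"
          using \<open>s \<in> {s\<in>?U. c s > 0}\<close> by auto
        then show ?thesis
        proof cases
          case (1 j)
          then have j: "j \<in> {1..q}" using IB_subset by blast
          have "w j = normalize_hat (m j) (g j z)"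
            using w[OF j] near[OF z'(1)] 1(2) by (simp add: eig_dir_def)
          then show ?thesis using bound1[OF j, of 1] pos[of j] 1 by (simp add: Dfam_def)
        next
          case (2 j)
          then have j: "j \<in> {1..q}" using I0_subset by blast
          show ?thesis using bound1[OF j, of 2] pos[of j] 2 by (simp add: Dfam_def dbl)
        next
          case (3 j)
          then have j: "j \<in> {1..q}" using I0_subset by blast
          show ?thesis using bound2[OF j, of 2] pos2[of j] 3 by (simp add: Dfam_def dbl)
        qed
      qed
    qed (use N0 \<delta> L2_set_nonneg in auto)
  qed
  \<comment> \<open>as the penalty parameter grows, the minimisers accumulate at a feasible point\<close>
  have main: "infdist x (feasible q m g)
      \<le> (2 * N / \<epsilon>) * L2_set (\<lambda>j. enorm (m j) (\<lambda>i. g j x i - p j i)) {1..q}"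
    if x: "x \<in> ball xb (r / 2)" and p: "\<And>j. j \<in> {1..q} \<Longrightarrow> p j \<in> soc (m j)" for x p
  proof -
    let ?L = "L2_set (\<lambda>j. enorm (m j) (\<lambda>i. g j x i - p j i)) {1..q}"
    define \<Phi> where "\<Phi> k y = (norm (y - x))\<^sup>2 + real k * total_gap y" for k y
    have x2: "norm (xb - x) < r / 2" using x by (simp add: dist_norm)
    have gap_xb: "total_gap xb = 0" using xb total_gap_eq_0_iff by simp
    have "\<exists>z\<in>cball xb r. \<forall>y\<in>cball xb r. \<Phi> k z \<le> \<Phi> k y" for k
    proof (rule continuous_attains_inf)
      show "continuous_on (cball xb r) (\<Phi> k)"
        unfolding \<Phi>_def
        by (intro continuous_intros continuous_at_imp_continuous_on ballI)
          (simp add: isCont_def tendsto_total_gap)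
    qed (use r in auto)
    then obtain z where z: "\<And>k. z k \<in> cball xb r" "\<And>k y. y \<in> cball xb r \<Longrightarrow> \<Phi> k (z k) \<le> \<Phi> k y"
      by metis
    have zxb: "(norm (z k - x))\<^sup>2 + real k * total_gap (z k) \<le> (norm (xb - x))\<^sup>2" for k
      using z(2)[of xb k] r gap_xb by (simp add: \<Phi>_def)
    have zx: "norm (z k - x) \<le> norm (xb - x)" for k
    proof -
      have "(norm (z k - x))\<^sup>2 \<le> (norm (xb - x))\<^sup>2"
        using zxb[of k] total_gap_nonneg[of "z k"] by (smt (verit) mult_nonneg_nonneg of_nat_0_le_iff)
      then show ?thesis by (simp add: power2_le_iff_abs_le)
    qed
    have z_ball: "z k \<in> ball xb r" for k
    proof -
      have "norm (xb - z k) \<le> norm (xb - x) + norm (z k - x)"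
        using norm_triangle_ineq4[of "xb - x" "z k - x"] by simp
      then show ?thesis using zx[of k] x2 by (simp add: dist_norm)
    qed
    have "x \<in> ball xb r" using x r(1) by simp
    then have est: "\<epsilon> * norm (z k - x) \<le> 2 * N * ?L" for k
      using z(2)[of _ k] p by (intro step[OF _ z_ball, where \<rho> = "real k"]) (auto simp: \<Phi>_def)
    obtain y s where s: "strict_mono (s :: nat \<Rightarrow> nat)" and y: "(\<lambda>k. z (s k)) \<longlonglongrightarrow> y"
      using compact_cball[of xb r, unfolded compact_def] z(1) by (fastforce simp: o_def)
    have "total_gap y = 0"
    proof -
      have "(\<lambda>k. total_gap (z (s k))) \<longlonglongrightarrow> 0"
      proof (rule Lim_null_comparison[OF eventually_sequentiallyI[of 1]])
        fix k :: nat assume "1 \<le> k"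
        then have sk: "0 < real (s k)" "real k \<le> real (s k)"
          using seq_suble[OF s, of k] by auto
        have "real (s k) * total_gap (z (s k)) \<le> (norm (xb - x))\<^sup>2"
          using zxb[of "s k"] by (smt (verit) zero_le_power2)
        moreover have "real k * total_gap (z (s k)) \<le> real (s k) * total_gap (z (s k))"
          using sk total_gap_nonneg by (intro mult_right_mono) auto
        ultimately have "real k * total_gap (z (s k)) \<le> (norm (xb - x))\<^sup>2" by linarith
        then show "norm (total_gap (z (s k))) \<le> (norm (xb - x))\<^sup>2 / real k"
          using \<open>1 \<le> k\<close> total_gap_nonneg[of "z (s k)"] by (simp add: pos_le_divide_eq mult.commute)
      next
        show "(\<lambda>k. (norm (xb - x))\<^sup>2 / real k) \<longlonglongrightarrow> 0" by (rule lim_const_over_n)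
      qed
      then show ?thesis using tendsto_total_gap[OF y] LIMSEQ_unique by blast
    qed
    then have "y \<in> feasible q m g" by (simp add: total_gap_eq_0_iff)
    then have "infdist x (feasible q m g) \<le> norm (y - x)"
      using infdist_le[of y "feasible q m g" x] by (simp add: dist_norm norm_minus_commute)
    moreover have "\<epsilon> * norm (y - x) \<le> 2 * N * ?L"
    proof (rule LIMSEQ_le_const2)
      show "(\<lambda>k. \<epsilon> * norm (z (s k) - x)) \<longlonglongrightarrow> \<epsilon> * norm (y - x)" by (intro tendsto_intros y)
    qed (use est in auto)
    then have "norm (y - x) \<le> (2 * N / \<epsilon>) * ?L" using \<epsilon> by (simp add: field_simps)
    ultimately show ?thesis by linarith
  qed
  \<comment> \<open>\<open>N\<close> vanishes for \<open>q = 0\<close>, hence the summand 1\<close>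
  define \<gamma> where "\<gamma> = 2 * N / \<epsilon> + 1"
  have \<gamma>: "\<gamma> > 0" using N0 \<epsilon> by (auto simp: \<gamma>_def intro: add_nonneg_pos)
  have "infdist x (feasible q m g) \<le> \<gamma> * dist_cones q m (\<lambda>j. g j x)" if x: "x \<in> ball xb (r / 2)" for x
  proof -
    have "infdist x (feasible q m g) / \<gamma> \<le> dist_cones q m (\<lambda>j. g j x)"
      unfolding dist_cones_def
    proof (rule cINF_greatest)
      have "(\<lambda>j\<in>{1..q}. g j xb) \<in> (\<Pi>\<^sub>E j\<in>{1..q}. soc (m j))" using xb by (auto simp: feasible_def)
      then show "(\<Pi>\<^sub>E j\<in>{1..q}. soc (m j)) \<noteq> {}" by blast
      fix p assume "p \<in> (\<Pi>\<^sub>E j\<in>{1..q}. soc (m j))"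
      then have "infdist x (feasible q m g)
          \<le> (2 * N / \<epsilon>) * L2_set (\<lambda>j. enorm (m j) (\<lambda>i. g j x i - p j i)) {1..q}"
        by (intro main[OF x]) auto
      also have "\<dots> \<le> \<gamma> * L2_set (\<lambda>j. enorm (m j) (\<lambda>i. g j x i - p j i)) {1..q}"
        by (intro mult_right_mono L2_set_nonneg) (simp add: \<gamma>_def)
      finally show "infdist x (feasible q m g) / \<gamma>
          \<le> L2_set (\<lambda>j. enorm (m j) (\<lambda>i. g j x i - p j i)) {1..q}"
        using \<gamma> by (simp add: pos_divide_le_eq mult.commute)
    qed
    then show ?thesis using \<gamma> by (simp add: pos_divide_le_eq mult.commute)
  qed
  then show ?thesis
    unfolding MSCQ_def using \<gamma> r(1) by (intro exI[of _ \<gamma>] conjI exI[of _ "ball xb (r / 2)"]) auto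
qed

lemma seq_CQ_persists_and_MSCQ:
  assumes K: "closed K" "cone K" "{0..} \<subseteq> K"
    and xb: "xb \<in> feasible q m g" and cq: "seq_CQ (dep_on K) q m g xb"
  shows "(\<exists>V. open V \<and> xb \<in> V \<and> (\<forall>x \<in> V \<inter> feasible q m g. seq_CQ (dep_on K) q m g x)) \<and>
    MSCQ q m g xb"
proof
  have loc: "local_CQ K xb" by (rule seq_CQ_imp_local_CQ[OF cq])
  then show "MSCQ q m g xb"
    by (rule local_CQ_imp_MSCQ[OF xb local_CQ_mono[OF K(3)]])
  obtain V where "open V" "xb \<in> V" "\<forall>x\<in>V. local_CQ K x"
    using local_CQ_persists[OF K(1,2) xb loc] unfolding eventually_nhds by blast
  then show "\<exists>V. open V \<and> xb \<in> V \<and> (\<forall>x \<in> V \<inter> feasible q m g. seq_CQ (dep_on K) q m g x)"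
    using local_CQ_imp_seq_CQ by (intro exI[of _ V]) auto
qed

end

theorem theorem5p2:
  fixes f :: "real ^ 'n \<Rightarrow> real"
    and q :: nat
    and m :: "nat \<Rightarrow> nat"
    and g :: "nat \<Rightarrow> real ^ 'n \<Rightarrow> nat \<Rightarrow> real"
    and xb :: "real ^ 'n"
  assumes f_C1: "C1 f"
    and m_ge_2: "\<And>j. j \<in> {1..q} \<Longrightarrow> m j \<ge> 2"
    and g_range: "\<And>j x. j \<in> {1..q} \<Longrightarrow> g j x \<in> topspace (Euclidean_space (m j))"
    and g_C1: "\<And>j i. j \<in> {1..q} \<Longrightarrow> i < m j \<Longrightarrow> C1 (\<lambda>x. g j x i)"
    and xb_feasible: "xb \<in> feasible q m g"
  shows "(seq_CPLD q m g xb \<longrightarrow>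
            (\<exists>V. open V \<and> xb \<in> V \<and> (\<forall>x \<in> V \<inter> feasible q m g. seq_CPLD q m g x)) \<and>
            MSCQ q m g xb) \<and>
         (seq_CRCQ q m g xb \<longrightarrow>
            (\<exists>V. open V \<and> xb \<in> V \<and> (\<forall>x \<in> V \<inter> feasible q m g. seq_CRCQ q m g x)) \<and>
            MSCQ q m g xb)"
proof -
  interpret soc_constraints q m g
    using m_ge_2 g_range g_C1 by unfold_locales auto
  show ?thesis
    unfolding seq_CPLD_def seq_CRCQ_def lin_dep_eq_dep_on pos_lin_dep_eq_dep_on
    using seq_CQ_persists_and_MSCQ[OF _ _ _ xb_feasible, of "{0..}"]
      seq_CQ_persists_and_MSCQ[OF _ _ _ xb_feasible, of UNIV]
    by (simp add: cone_def)
qed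

end
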